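(* Let $n\ge1$ be an integer. The maximum of $\operatorname{sd}(\mathcal R(A,b))$ over all real matrices $A$ with $n$ columns and all real vectors $b$ of matching length (any number of rows) such that $P(A,b)=\{x\in\{0,1\}^n: Ax=b\}\neq\emptyset$ is $$\max_{A,b:\,P(A,b)\neq\emptyset}\operatorname{sd}(\mathcal R(A,b))=\begin{cases}1,&n=1,\\ \lfloor n/2\rfloor,&n\ge2.\end{cases}$$
   Context: $\mathbb S^p$ is the space of real symmetric $p\times p$ matrices with inner product $\langle X,Y\rangle=\operatorname{tr}(XY)$, and $\mathbb S^p_+$ is the positive semidefinite cone. Matrices in $\mathbb S^{n+1}$ have rows and columns indexed by $0,1,\dots,n$. Equality-generated SDP--RLT relaxation: for $A\in\mathbb R^{q\times n}$, $b\in\mathbb R^q$, $$\mathcal R(A,b)=\left\{Y=\begin{pmatrix} 1 & x^T \\ x & X \end{pmatrix}\in\mathbb S^{n+1}_+ : \operatorname{diag}(X)=x,\ Ax=b,\ AX=bx^T\right\}=L\cap\mathbb S^{n+1}_+,$$ where $L\subseteq\mathbb S^{n+1}$ is the affine subspace defined by $Y_{00}=1$, $Y_{ii}=Y_{0i}$ ($i=1,\dots,n$) and $\begin{pmatrix}-b&A\end{pmatrix}Y=0$. Singularity degree: for a set $S$, $S^\perp=\{z:\langle z,s\rangle=0\ \forall s\in S\}$; for a cone $K$, $K^*=\{z:\langle z,x\rangle\ge0\ \forall x\in K\}$. Let $L\subseteq\mathbb S^p$ be an affine subspace with $L\cap\mathbb S^p_+\ne\emptyset$ and let $F_{\min}$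 be the minimal face of $\mathbb S^p_+$ containing $L\cap\mathbb S^p_+$. A facial-reduction sequence of length $d\ge0$ consists of faces $F_0=\mathbb S^p_+,F_1,\dots,F_d$ and matrices $W_j\in L^\perp\cap(F_{j-1}^*\setminus F_{j-1}^\perp)$ with $F_j=F_{j-1}\cap W_j^\perp$ ($j=1,\dots,d$), and $F_d=F_{\min}$. The singularity degree $\operatorname{sd}(L\cap\mathbb S^p_+)$ is the minimum length of a facial-reduction sequence; it is taken with respect to the affine subspace $L$ given by the defining equality constraints. *)

theory Defs
  imports "HOL-Analysis.Analysis" "HOL-Library.Extended_Nat"
begin

section \<open>Symmetric matrices, faces and singularity degree\<close>

text \<open>
  The type \<^typ>\<open>real^'m^'m\<close> also contains non-symmetric matrices, so orthogonal
  complements and dual cones are explicitly taken inside the space of symmetric matrices.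
\<close>

definition sym_mats :: "(real^'m^'m) set" where
  "sym_mats = {X. transpose X = X}"

definition psd_cone :: "(real^'m^'m) set" where
  "psd_cone = {X \<in> sym_mats. \<forall>v. 0 \<le> v \<bullet> (X *v v)}"

definition tr_inner :: "real^'m^'m \<Rightarrow> real^'m^'m \<Rightarrow> real" where
  "tr_inner X Y = trace (X ** Y)"

definition perp :: "(real^'m^'m) set \<Rightarrow> (real^'m^'m) set" where
  "perp S = {Z \<in> sym_mats. \<forall>X\<in>S. tr_inner Z X = 0}"

definition dual_cone :: "(real^'m^'m) set \<Rightarrow> (real^'m^'m) set" where
  "dual_cone K = {Z \<in> sym_mats. \<forall>X\<in>K. 0 \<le> tr_inner Z X}"

definition min_face :: "(real^'m^'m) set \<Rightarrow> (real^'m^'m) set" where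
  "min_face L = \<Inter> {F. F face_of psd_cone \<and> L \<inter> psd_cone \<subseteq> F}"

definition facial_reduction_seq ::
    "(real^'m^'m) set \<Rightarrow> nat \<Rightarrow> (nat \<Rightarrow> (real^'m^'m) set) \<Rightarrow> (nat \<Rightarrow> real^'m^'m) \<Rightarrow> bool" where
  "facial_reduction_seq L d F W \<longleftrightarrow>
     F 0 = psd_cone \<and>
     (\<forall>j\<le>d. F j face_of psd_cone) \<and>
     (\<forall>j\<in>{1..d}. W j \<in> perp L \<inter> (dual_cone (F (j - 1)) - perp (F (j - 1))) \<and>
                 F j = F (j - 1) \<inter> perp {W j}) \<and>
     F d = min_face L"

text \<open>
  The set of lengths is nonempty whenever \<open>L\<close> is an affine subspace of the symmetric matrices
  meeting \<^const>\<open>psd_cone\<close>, and the infimum is then a minimum; with values in \<^typ>\<open>enat\<close>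
  no junk value can arise (the degree would be \<open>\<infinity>\<close> if no sequence existed).
\<close>

definition singularity_degree :: "(real^'m^'m) set \<Rightarrow> enat" where
  "singularity_degree L = (INF d \<in> {d. \<exists>F W. facial_reduction_seq L d F W}. enat d)"


section \<open>The equality-generated SDP--RLT relaxation\<close>

text \<open>
  The \<open>n\<close> variables are indexed by a finite type \<open>'n\<close>. The indices \<open>0, 1, \<dots>, n\<close> of the lifted
  matrices are the elements of \<^typ>\<open>'n option\<close>, with \<^const>\<open>None\<close> playing the role of \<open>0\<close>.
  Since the number \<open>q\<close> of rows has to be quantified over, a system \<open>A x = b\<close> is given
  by \<open>q\<close>, the rows \<open>A 0, \<dots>, A (q - 1)\<close> and the right-hand sides \<open>b 0, \<dots>, b (q - 1)\<close>;
  the values of \<open>A\<close> and \<open>b\<close> at indices \<open>\<ge> q\<close> are ignored.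
\<close>

definition binary_solutions :: "nat \<Rightarrow> (nat \<Rightarrow> real^'n) \<Rightarrow> (nat \<Rightarrow> real) \<Rightarrow> (real^'n) set" where
  "binary_solutions q A b = {x. (\<forall>i. x $ i \<in> {0, 1}) \<and> (\<forall>k<q. A k \<bullet> x = b k)}"

text \<open>The \<open>k\<close>-th row of the block matrix \<open>(-b  A)\<close>.\<close>

definition homog_row :: "(nat \<Rightarrow> real^'n) \<Rightarrow> (nat \<Rightarrow> real) \<Rightarrow> nat \<Rightarrow> real^('n option)" where
  "homog_row A b k = (\<chi> j. case j of None \<Rightarrow> - b k | Some i \<Rightarrow> A k $ i)"

definition rlt_affine ::
    "nat \<Rightarrow> (nat \<Rightarrow> real^'n) \<Rightarrow> (nat \<Rightarrow> real) \<Rightarrow> (real^('n option)^('n option)) set" where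
  "rlt_affine q A b =
     {Y \<in> sym_mats. Y $ None $ None = 1 \<and>
        (\<forall>i. Y $ Some i $ Some i = Y $ None $ Some i) \<and>
        (\<forall>k<q. homog_row A b k v* Y = 0)}"

definition rlt_relaxation ::
    "nat \<Rightarrow> (nat \<Rightarrow> real^'n) \<Rightarrow> (nat \<Rightarrow> real) \<Rightarrow> (real^('n option)^('n option)) set" where
  "rlt_relaxation q A b =
     {Y \<in> psd_cone. Y $ None $ None = 1 \<and>
        (let x = (\<chi> i. Y $ Some i $ None); X = (\<chi> i j. Y $ Some i $ Some j) in
          (\<forall>i. X $ i $ i = x $ i) \<and>
          (\<forall>k<q. A k \<bullet> x = b k) \<and>
          (\<forall>k<q. A k v* X = b k *\<^sub>R x))}"

lemma sum_option:
  fixes f :: "'a::finite option \<Rightarrow> real"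
  shows "(\<Sum>j\<in>UNIV. f j) = f None + (\<Sum>i\<in>UNIV. f (Some i))"
  by (simp add: UNIV_option_conv sum.reindex)

lemma rlt_relaxation_eq:
  fixes A :: "nat \<Rightarrow> real^'n::finite"
  shows "rlt_relaxation q A b = rlt_affine q A b \<inter> psd_cone"
proof -
  have *: "homog_row A b k v* Y = 0 \<longleftrightarrow>
      A k \<bullet> (\<chi> i. Y $ Some i $ None) = b k \<and>
      A k v* (\<chi> i j. Y $ Some i $ Some j) = b k *\<^sub>R (\<chi> i. Y $ Some i $ None)"
    if Y: "Y \<in> sym_mats" "Y $ None $ None = 1" for Y :: "real^('n option)^('n option)" and k
  proof -
    have s: "Y $ None $ Some i = Y $ Some i $ None" for i
      using Y(1) unfolding sym_mats_def transpose_def mem_Collect_eq vec_eq_iff vec_lambda_beta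
      by blast
    have "homog_row A b k v* Y = 0 \<longleftrightarrow>
      (\<forall>j. (\<Sum>i\<in>UNIV. A k $ i * Y $ Some i $ j) - b k * Y $ None $ j = 0)"
      by (simp add: vec_eq_iff vector_matrix_mult_def homog_row_def sum_option mult.commute)
    also have "\<dots> \<longleftrightarrow>
      (\<Sum>i\<in>UNIV. A k $ i * Y $ Some i $ None) = b k \<and>
      (\<forall>j. (\<Sum>i\<in>UNIV. A k $ i * Y $ Some i $ Some j) = b k * Y $ Some j $ None)"
      by (simp add: split_option_all Y(2) s)
    finally show ?thesis
      by (simp add: vec_eq_iff vector_matrix_mult_def inner_vec_def mult.commute)
  qed
  have s: "Y $ Some i $ None = Y $ None $ Some i" if "Y \<in> sym_mats"
    for Y :: "real^('n option)^('n option)" and i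
    using that unfolding sym_mats_def transpose_def mem_Collect_eq vec_eq_iff vec_lambda_beta
    by blast
  have "Y \<in> rlt_relaxation q A b \<longleftrightarrow> Y \<in> rlt_affine q A b \<inter> psd_cone" for Y
  proof (cases "Y \<in> psd_cone \<and> Y $ None $ None = 1")
    case True
    then have Y: "Y \<in> sym_mats" "Y $ None $ None = 1" "Y \<in> psd_cone"
      by (simp_all add: psd_cone_def)
    show ?thesis
      unfolding rlt_relaxation_def rlt_affine_def Let_def mem_Collect_eq Int_iff *[OF Y(1,2)]
        vec_lambda_beta s[OF Y(1)] using Y by blast
  next
    case False
    then show ?thesis
      unfolding rlt_relaxation_def rlt_affine_def by blast
  qed
  then show ?thesis by blast
qed

end

theory Submission
  imports Defs
begin

text \<open>
  Every matrix in the relaxation has its range in \<open>V = {(x\<^sub>0, x). A x = x\<^sub>0 b}\<close>, and restricted to \<open>V\<close>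
  the space \<open>L\<^sup>\<bottom>\<close> consists of the forms \<open>\<Sum>i. l\<^sub>i (x\<^sub>i\<^sup>2 - x\<^sub>0 x\<^sub>i)\<close>. The restriction to \<open>V\<close>
  can be carried out together with the first reduction by such a form, so facial reduction amounts to
  shrinking \<open>V\<close> repeatedly to the kernel of a form that is nonnegative on it. After reflecting
  coordinates, a binary point of \<open>V\<close> becomes \<open>x = 0\<close>, and with \<open>U = V \<inter> {x\<^sub>0 = 0} \<subseteq> \<real>\<^sup>n\<close>
  nonnegativity means that \<open>l\<close> is orthogonal to \<open>U\<close> and \<open>\<Sum>i. l\<^sub>i x\<^sub>i\<^sup>2 \<ge> 0\<close> on \<open>U\<close>. The number of
  steps is at most \<open>dim U\<close>, and also at most \<open>n - dim U\<close>, hence at most \<open>n div 2\<close>.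

  For the lower bound, let \<open>x\<close> have distinct nonzero entries and let \<open>U\<close> be spanned by the
  componentwise powers \<open>x, x\<^sup>2, \<dots>, x\<^sup>k\<close> with \<open>k = n div 2\<close>. Positive semidefiniteness of a Hankel
  matrix forces each step to remove only the highest power, so \<open>k\<close> steps are needed to reach \<open>0\<close>.
\<close>

section \<open>Projections, dimension counts and kernels of semidefinite forms\<close>

lemma orth_projection_exists:
  fixes B :: "'a::euclidean_space set"
  assumes "subspace B"
  obtains P where "linear P" "\<And>x. P x \<in> B" "\<And>x b. b \<in> B \<Longrightarrow> (x - P x) \<bullet> b = 0"
proof -
  obtain S where S: "S \<subseteq> B" "pairwise orthogonal S" "\<And>x. x \<in> S \<Longrightarrow> norm x = 1"
      "independent S" "span S = B"
    using orthonormal_basis_subspace[OF assms] by metis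
  have fin: "finite S" using S(4) by (rule independent_imp_finite)
  define P where "P x = (\<Sum>b\<in>S. (x \<bullet> b) *\<^sub>R b)" for x
  have ortho: "b \<bullet> c = (if b = c then 1 else 0)" if "b \<in> S" "c \<in> S" for b c
  proof (cases "b = c")
    case True
    then show ?thesis using S(3)[OF that(1)] by (simp add: dot_square_norm)
  next
    case False
    then show ?thesis using S(2) that by (simp add: pairwise_def orthogonal_def)
  qed
  show thesis
  proof
    show "linear P"
      by (rule linearI)
        (simp_all add: P_def inner_add_left scaleR_left_distrib sum.distrib scaleR_right.sum)
    show "P x \<in> B" for x
      unfolding P_def using S(1) by (intro subspace_sum subspace_scale) (auto simp: assms)
    show "(x - P x) \<bullet> b = 0" if "b \<in> B" for x b
    proof -
      have "b \<in> span S" using that S(5) by simp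
      then show ?thesis
      proof (induction b rule: span_induct_alt)
        case base
        then show ?case by simp
      next
        case (step c s y)
        have "P x \<bullet> s = (\<Sum>b\<in>S. if b = s then x \<bullet> b else 0)"
          unfolding P_def inner_sum_left using step(1) by (intro sum.cong) (auto simp: ortho)
        also have "\<dots> = x \<bullet> s" using step(1) fin by simp
        finally show ?case using step by (simp add: inner_diff_left inner_add_right)
      qed
    qed
  qed
qed

text \<open>The sum of \<open>V'\<close> and \<open>S\<close> stays inside \<open>V\<close>, so the
  dimension formula applies: passing from \<open>V\<close> to \<open>V'\<close> costs a subspace
  \<open>S\<close> of \<open>V\<close> no more dimensions than it costs \<open>V\<close>.\<close>

lemma dim_Int_mono:
  fixes V V' S :: "'a::euclidean_space set"
  assumes "subspace V" "subspace V'" "subspace S" "V' \<subseteq> V" "S \<subseteq> V"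
  shows "dim V' + dim S \<le> dim V + dim (S \<inter> V')"
proof -
  have "{x + y |x y. x \<in> V' \<and> y \<in> S} \<subseteq> V"
    using assms by (auto intro!: subspace_add)
  then have "dim {x + y |x y. x \<in> V' \<and> y \<in> S} \<le> dim V"
    by (rule dim_subset)
  with dim_sums_Int[OF assms(2,3)] show ?thesis
    by (simp add: Int_commute)
qed

text \<open>The set on the right is the left radical of the pairing \<open>f x \<bullet> b\<close>
  of \<open>X\<close> with \<open>B\<close>. Its complement \<open>C\<close> in \<open>X\<close>
  embeds, by \<open>f\<close> followed by projection to \<open>B\<close>, into the part of
  \<open>B\<close> orthogonal to \<open>T\<close>.\<close>

lemma dim_pairing_le:
  fixes f :: "'b::euclidean_space \<Rightarrow> 'a::euclidean_space"
  assumes "linear f" "subspace X" "subspace T" "subspace B" "T \<subseteq> B"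
    and orth: "\<And>x t. x \<in> X \<Longrightarrow> t \<in> T \<Longrightarrow> f x \<bullet> t = 0"
  shows "dim X + dim T \<le> dim B + dim {x \<in> X. \<forall>b\<in>B. f x \<bullet> b = 0}"
proof -
  define K where "K = {x \<in> X. \<forall>b\<in>B. f x \<bullet> b = 0}"
  have K: "subspace K" "K \<subseteq> X"
    unfolding K_def subspace_def using assms(1,2)
    by (auto simp: linear_0 linear_add linear_cmul inner_add_left subspace_0 subspace_add subspace_scale)
  define C where "C = {y \<in> X. \<forall>x\<in>K. orthogonal x y}"
  have C: "subspace C"
    unfolding C_def subspace_def using assms(2)
    by (auto simp: orthogonal_def inner_add_right subspace_0 subspace_add subspace_scale)
  have dC: "dim C + dim K = dim X"
    unfolding C_def by (rule dim_subspace_orthogonal_to_vectors[OF K(1) assms(2) K(2)])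
  obtain P where P: "linear P" "\<And>x. P x \<in> B" "\<And>x b. b \<in> B \<Longrightarrow> (x - P x) \<bullet> b = 0"
    using orth_projection_exists[OF assms(4)] by blast
  have lin: "linear (\<lambda>x. P (f x))"
    using linear_compose[OF assms(1) P(1)] by (simp add: o_def)
  have Pb: "P x \<bullet> b = x \<bullet> b" if "b \<in> B" for x b
    using P(3)[OF that, of x] by (simp add: inner_diff_left)
  have inj: "inj_on (\<lambda>x. P (f x)) (span C)"
  proof (subst linear_injective_on_subspace_0[OF lin subspace_span], clarify)
    fix x assume "x \<in> span C" and x0: "P (f x) = 0"
    then have x: "x \<in> C" using C span_eq_iff by blast
    have "x \<in> K"
      unfolding K_def using x x0 Pb[of _ "f x"] by (auto simp: C_def)
    then have "orthogonal x x" using x unfolding C_def by blast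
    then show "x = 0" by (simp add: orthogonal_def)
  qed
  have "dim C = dim ((\<lambda>x. P (f x)) ` C)"
    by (rule sym, rule dim_image_eq[OF lin inj])
  also have "\<dots> \<le> dim {y \<in> B. \<forall>x\<in>T. orthogonal x y}"
  proof (rule dim_subset, clarify, intro conjI ballI)
    fix x t assume "x \<in> C" "t \<in> T"
    then show "orthogonal t (P (f x))"
      using orth[of x t] Pb[of t "f x"] assms(5)
      by (auto simp: C_def orthogonal_def inner_commute)
  qed (use P in auto)
  finally show ?thesis
    using dim_subspace_orthogonal_to_vectors[OF assms(3,4,5)] dC
    unfolding K_def by linarith
qed

text \<open>If \<open>f u w\<close> were nonzero, the form at \<open>w + t *\<^sub>R u\<close> would
  be affine in \<open>t\<close> with nonzero slope; the chosen \<open>t\<close> makes it -1.\<close>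

lemma psd_bilinear_kernel:
  fixes f :: "'a::real_vector \<Rightarrow> 'a \<Rightarrow> real"
  assumes f: "bilinear f" "\<And>x y. f x y = f y x"
    and V: "subspace V" "\<And>v. v \<in> V \<Longrightarrow> 0 \<le> f v v"
    and u: "u \<in> V" "f u u = 0" and w: "w \<in> V"
  shows "f u w = 0"
proof (rule ccontr)
  assume ne: "f u w \<noteq> 0"
  define t where "t = - (f w w + 1) / (2 * f u w)"
  have "0 \<le> f (w + t *\<^sub>R u) (w + t *\<^sub>R u)"
    using V u w by (intro V(2) subspace_add subspace_scale)
  also have "\<dots> = f w w + 2 * t * f u w"
    using f(2)[of w u] u(2)
    by (simp add: bilinear_ladd[OF f(1)] bilinear_radd[OF f(1)] bilinear_lmul[OF f(1)]
        bilinear_rmul[OF f(1)] algebra_simps)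
  also have "\<dots> = - 1"
    using ne by (simp add: t_def field_simps)
  finally show False by simp
qed

lemma subspace_psd_kernel:
  fixes f :: "'a::real_vector \<Rightarrow> 'a \<Rightarrow> real"
  assumes f: "bilinear f" "\<And>x y. f x y = f y x"
    and V: "subspace V" "\<And>v. v \<in> V \<Longrightarrow> 0 \<le> f v v"
  shows "subspace {v \<in> V. f v v = 0}"
proof -
  have "{v \<in> V. f v v = 0} = {v \<in> V. \<forall>w\<in>V. f v w = 0}"
    using psd_bilinear_kernel[OF f V] by blast
  moreover have "subspace {v \<in> V. \<forall>w\<in>V. f v w = 0}"
    unfolding subspace_def using V(1)
    by (auto simp: bilinear_ladd[OF f(1)] bilinear_lmul[OF f(1)] bilinear_lzero[OF f(1)]
        subspace_0 subspace_add subspace_scale)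
  ultimately show ?thesis by simp
qed

section \<open>Chains of weights\<close>

text \<open>One reduction once a binary point has been moved to the origin; products are
  componentwise. As \<open>x0\<close> is then free, nonnegativity of the form forces its linear part
  to vanish on \<open>U\<close> and its quadratic part to be nonnegative there.\<close>

definition weight_step :: "real^'n \<Rightarrow> (real^'n) set \<Rightarrow> (real^'n) set \<Rightarrow> bool" where
  "weight_step l U U' \<longleftrightarrow> (\<forall>u\<in>U. l \<bullet> u = 0) \<and> (\<forall>u\<in>U. 0 \<le> l \<bullet> (u * u)) \<and>
     U' = {u \<in> U. l \<bullet> (u * u) = 0} \<and> U' \<noteq> U"

inductive weight_chain :: "(real^'n) set \<Rightarrow> nat \<Rightarrow> bool" where
  Nil: "weight_chain U 0"
| Cons: "weight_step l U U' \<Longrightarrow> weight_chain U' k \<Longrightarrow> weight_chain U (Suc k)"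

lemma bilinear_weight: "bilinear (\<lambda>x y. (l::real^'n) \<bullet> (x * y))"
  unfolding bilinear_def
  by (intro conjI allI linearI) (simp_all add: algebra_simps inner_add_right)

lemma inner_times_assoc: "(x * y) \<bullet> z = x \<bullet> (y * (z::real^'n))"
  by (simp add: inner_vec_def mult.assoc)

lemma weight_kernel:
  assumes "weight_step l U U'" "subspace U" "u \<in> U'" "w \<in> U"
  shows "l \<bullet> (u * w) = 0"
  using psd_bilinear_kernel[OF bilinear_weight, of l U u w] assms
  by (auto simp: weight_step_def mult.commute)

lemma weight_step_subspace:
  assumes "weight_step l U U'" "subspace U"
  shows "subspace U'" "U' \<subset> U"
  using subspace_psd_kernel[OF bilinear_weight, of l U] assms
  by (auto simp: weight_step_def mult.commute)

lemma weight_chain_le_dim: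
  assumes "weight_chain U k" "subspace U"
  shows "k \<le> dim U"
  using assms
proof (induction rule: weight_chain.induct)
  case (Cons l U U' k)
  have "dim U' < dim U"
    using weight_step_subspace[OF Cons(1,4)] Cons(4)
    by (metis dim_psubset span_eq_iff)
  with Cons weight_step_subspace show ?case by fastforce
qed simp

text \<open>Intersect every space of the chain with \<open>S\<close> and drop the steps that become
  trivial. A dropped step lowers the dimension of the ambient space while \<open>S\<close> is
  unchanged; a kept step costs \<open>S\<close> no more than the ambient space. Hence the number of
  dropped steps is at most \<open>dim U - dim S\<close>.\<close>

lemma weight_chain_restrict:
  assumes "weight_chain U k" "subspace U" "subspace S" "S \<subseteq> U"
  shows "\<exists>k'\<le>k. weight_chain S k' \<and> k + dim S \<le> k' + dim U"
  using assms
proof (induction arbitrary: S rule: weight_chain.induct)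
  case (Nil U)
  then show ?case using weight_chain.Nil dim_subset[of S U] by auto
next
  case (Cons l U U' k)
  note sub = weight_step_subspace[OF Cons(1,4)]
  have S': "subspace (S \<inter> U')" using Cons.prems sub by (simp add: subspace_inter)
  obtain k' where k': "k' \<le> k" "weight_chain (S \<inter> U') k'" "k + dim (S \<inter> U') \<le> k' + dim U'"
    using Cons.IH[OF sub(1) S'] by auto
  have d: "dim U' + dim S \<le> dim U + dim (S \<inter> U')"
    using dim_Int_mono Cons.prems sub by blast
  show ?case
  proof (cases "S \<subseteq> U'")
    case True
    have "dim U' < dim U"
      using sub Cons.prems(1) by (metis dim_psubset span_eq_iff)
    then show ?thesis using k' True by (intro exI[of _ k']) (auto simp: Int_absorb2)
  next
    case False
    have "weight_step l S (S \<inter> U')"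
      using Cons(1) Cons.prems False unfolding weight_step_def by blast
    then have "weight_chain S (Suc k')" using k'(2) by (rule weight_chain.Cons)
    then show ?thesis using k' d by (intro exI[of _ "Suc k'"]) auto
  qed
qed

text \<open>For a step with weight \<open>l\<close> from \<open>U\<close> to \<open>U1\<close>, let \<open>N\<close> be the radical of \<open>l\<close> on \<open>B\<close>. All
  \<open>l * y\<close> with \<open>y\<close> in \<open>U1\<close> or \<open>y = 1\<close> are orthogonal to \<open>U + N\<close>, which bounds the
  codimension of \<open>U\<close> from below. The rest of the chain is split between \<open>U1 / (U1 \<inter> N)\<close> and
  \<open>U1 \<inter> N\<close>, the latter handled inside the smaller algebra \<open>N\<close>. If some \<open>v \<in> U1\<close> acts
  as the unit modulo \<open>N\<close>, one dimension would be lost in this count; adjoining \<open>v\<close> to both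
  \<open>N\<close> and \<open>U1 \<inter> N\<close> recovers it.\<close>

lemma weight_chain_le_codim:
  assumes "weight_chain U k" "subspace U" "subspace B" "U \<subseteq> B"
    and mult: "\<And>x y. x \<in> B \<Longrightarrow> y \<in> B \<Longrightarrow> x * y \<in> B"
  shows "k + dim U \<le> dim B"
  using assms
proof (induction k arbitrary: U B rule: less_induct)
  case (less k)
  show ?case
  proof (cases k)
    case 0
    then show ?thesis using less.prems dim_subset by simp
  next
    case (Suc j)
    obtain l U1 where st: "weight_step l U U1" and ch: "weight_chain U1 j"
      using less.prems(1) Suc by (auto elim: weight_chain.cases)
    note sub = weight_step_subspace[OF st less.prems(2)]
    have sB: "\<And>c x. x \<in> B \<Longrightarrow> c *\<^sub>R x \<in> B" "\<And>x y. x \<in> B \<Longrightarrow> y \<in> B \<Longrightarrow> x + y \<in> B"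
       "\<And>x y. x \<in> B \<Longrightarrow> y \<in> B \<Longrightarrow> x - y \<in> B" "0 \<in> B"
      using less.prems(3) by (auto simp: subspace_scale subspace_add subspace_diff subspace_0)
    have lU: "l \<bullet> u = 0" if "u \<in> U" for u
      using st that by (auto simp: weight_step_def)
    \<comment> \<open>\<open>B\<close> need not contain \<open>1\<close>, so
      \<open>l \<bullet> x = 0\<close> is demanded separately. This makes \<open>N\<close> an ideal
      of \<open>B\<close> on which \<open>l\<close> vanishes.\<close>
    define N where "N = {x \<in> B. l \<bullet> x = 0 \<and> (\<forall>y\<in>B. l \<bullet> (x * y) = 0)}"
    have N: "subspace N" "N \<subseteq> B"
      unfolding N_def subspace_def by (auto simp: sB inner_add_right distrib_right)
    have NB: "x * y \<in> N" if "x \<in> N" "y \<in> B" for x y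
      using that unfolding N_def by (auto intro: less.prems(5) simp: mult.assoc)
    define K where "K = U1 \<inter> N"
    have K: "subspace K" unfolding K_def using sub N by (simp add: subspace_inter)
    \<comment> \<open>An element \<open>u\<close> of \<open>U\<close> in \<open>N\<close> has
      \<open>l \<bullet> (u * u) = 0\<close> and thus survives the step.\<close>
    have K_eq: "K = U \<inter> N"
      using st less.prems(4) unfolding K_def N_def weight_step_def by blast
    define T where "T = {x + y |x y. x \<in> U \<and> y \<in> N}"
    have T: "subspace T" "T \<subseteq> B"
      unfolding T_def using subspace_sums[OF less.prems(2) N(1)] less.prems(4) N(2) sB(2) by blast+
    have dT: "dim T + dim K = dim U + dim N"
      unfolding T_def K_eq using dim_sums_Int[OF less.prems(2) N(1)] by simp
    have lin: "linear (\<lambda>y. l * y)"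
      by (rule linearI) (simp_all add: distrib_left)
    have orthU1: "(l * x) \<bullet> t = 0" if x: "x \<in> U1" and t: "t \<in> T" for x t
    proof -
      obtain u n where un: "t = u + n" "u \<in> U" "n \<in> N" using t unfolding T_def by blast
      have "l \<bullet> (x * u) = 0" by (rule weight_kernel[OF st less.prems(2) x un(2)])
      moreover have "l \<bullet> (n * x) = 0"
        using un(3) x sub(2) less.prems(4) unfolding N_def by blast
      ultimately show ?thesis
        by (simp add: inner_times_assoc un(1) distrib_left inner_add_right mult.commute)
    qed
    have orth1: "(l * 1) \<bullet> t = 0" if "t \<in> T" for t
      using that lU unfolding T_def N_def by (auto simp: inner_add_right)
    \<comment> \<open>The cases ask whether \<open>l\<close> agrees on \<open>B\<close> with
      \<open>l * v\<close> for some \<open>v\<close> in \<open>U1\<close>. If not, adjoining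
      \<open>1\<close> to \<open>U1\<close> yields one more dimension of functionals orthogonal to
      \<open>T\<close>.\<close>
    show ?thesis
    proof (cases "\<exists>v\<in>U1. \<forall>x\<in>B. l \<bullet> ((v - 1) * x) = 0")
      case False
      define X where "X = span (insert 1 U1)"
      have "1 \<notin> U1" using False by force
      then have dX: "dim X = dim U1 + 1"
        unfolding X_def using sub by (simp add: dim_insert span_eq_iff[THEN iffD2])
      have X: "x \<in> X \<longleftrightarrow> (\<exists>c. x - c *\<^sub>R 1 \<in> U1)" for x
        unfolding X_def using sub by (simp add: span_insert span_eq_iff[THEN iffD2])
      have "dim X + dim T \<le> dim B + dim {x \<in> X. \<forall>b\<in>B. (l * x) \<bullet> b = 0}"
      proof (rule dim_pairing_le[OF lin _ T(1) less.prems(3) T(2)])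
        show "subspace X" by (simp add: X_def)
        fix x t assume "x \<in> X" and t: "t \<in> T"
        then obtain c where c: "x - c *\<^sub>R 1 \<in> U1" using X by blast
        have "l * x = l * (x - c *\<^sub>R 1) + c *\<^sub>R (l * 1)"
          by (simp add: algebra_simps)
        then show "(l * x) \<bullet> t = 0"
          using orthU1[OF c t] orth1[OF t] by (simp add: inner_add_left)
      qed
      also have "dim {x \<in> X. \<forall>b\<in>B. (l * x) \<bullet> b = 0} \<le> dim K"
      proof (rule dim_subset, clarify)
        fix x assume x: "x \<in> X" and xB: "\<forall>b\<in>B. (l * x) \<bullet> b = 0"
        from x obtain c where c: "x - c *\<^sub>R 1 \<in> U1" using X by blast
        have c0: "c = 0"
        proof (rule ccontr)
          assume "c \<noteq> 0"
          define v where "v = (- 1 / c) *\<^sub>R (x - c *\<^sub>R 1)"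
          have "v - 1 = (- 1 / c) *\<^sub>R x" using \<open>c \<noteq> 0\<close> by (simp add: v_def algebra_simps)
          then have "\<forall>b\<in>B. l \<bullet> ((v - 1) * b) = 0" using xB by (simp add: inner_times_assoc)
          moreover have "v \<in> U1" unfolding v_def by (rule subspace_scale[OF sub(1) c])
          ultimately show False using False by blast
        qed
        then have "x \<in> U1" using c by simp
        moreover from this have "l \<bullet> x = 0" "x \<in> B" using sub lU less.prems(4) by blast+
        ultimately show "x \<in> K" unfolding K_def N_def using xB by (simp add: inner_times_assoc)
      qed
      finally have 1: "dim X + dim T \<le> dim B + dim K" by simp
      obtain k' where k': "k' \<le> j" "weight_chain K k'" "j + dim K \<le> k' + dim U1"
        using weight_chain_restrict[OF ch sub(1) K] K_def by auto
      have "k' + dim K \<le> dim N"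
        using less.IH[OF _ k'(2) K N(1)] k'(1) Suc NB N(2) by (auto simp: K_def)
      then show ?thesis using 1 dX dT k' Suc by linarith
    next
      case True
      then obtain v where v: "v \<in> U1" and vB: "\<And>x. x \<in> B \<Longrightarrow> l \<bullet> ((v - 1) * x) = 0" by blast
      have vB': "v \<in> B" "l \<bullet> v = 0" using v sub less.prems(4) lU by blast+
      \<comment> \<open>If \<open>v\<close> were in \<open>N\<close>, then \<open>l\<close> would
        vanish on all of \<open>B\<close> and the step would not shrink \<open>U\<close>.\<close>
      have vN: "v \<notin> N"
      proof
        assume "v \<in> N"
        then have l0: "l \<bullet> x = 0" if "x \<in> B" for x
          using vB[OF that] that unfolding N_def by (auto simp: algebra_simps inner_diff_right)
        have "U1 = U" using st less.prems(4,5) l0 unfolding weight_step_def by blast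
        with sub show False by simp
      qed
      \<comment> \<open>\<open>v\<close> is idempotent modulo \<open>N\<close>, so \<open>N\<close>
        with \<open>v\<close> adjoined is closed under products, as the induction hypothesis
        requires.\<close>
      have vv: "v * v - v \<in> N"
        unfolding N_def using vB[OF vB'(1)] vB' vB sB less.prems(5)
        by (auto simp: algebra_simps inner_diff_right)
           (metis (no_types, lifting) less.prems(5) mult.assoc mult.commute)
      have "dim U1 + dim T \<le> dim B + dim {x \<in> U1. \<forall>b\<in>B. (l * x) \<bullet> b = 0}"
        by (rule dim_pairing_le[OF lin sub(1) T(1) less.prems(3) T(2) orthU1])
      also have "dim {x \<in> U1. \<forall>b\<in>B. (l * x) \<bullet> b = 0} \<le> dim K"
        using sub less.prems(4) lU
        by (intro dim_subset) (auto simp: K_def N_def inner_times_assoc)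
      finally have 1: "dim U1 + dim T \<le> dim B + dim K" by simp
      define B' where "B' = span (insert v N)"
      have B': "x \<in> B' \<longleftrightarrow> (\<exists>c. x - c *\<^sub>R v \<in> N)" for x
        unfolding B'_def using N by (simp add: span_insert span_eq_iff[THEN iffD2])
      have dB': "dim B' = dim N + 1"
        unfolding B'_def using N vN by (simp add: dim_insert span_eq_iff[THEN iffD2])
      have B'B: "B' \<subseteq> B"
        unfolding B'_def using N vB' less.prems(3) by (intro span_minimal) auto
      have multB': "x * y \<in> B'" if "x \<in> B'" "y \<in> B'" for x y
      proof -
        obtain c d where cd: "x - c *\<^sub>R v \<in> N" "y - d *\<^sub>R v \<in> N"
          using \<open>x \<in> B'\<close> \<open>y \<in> B'\<close> B' by blast
        have "x * y - (c * d) *\<^sub>R v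
          = (x - c *\<^sub>R v) * y + c *\<^sub>R ((y - d *\<^sub>R v) * v) + (c * d) *\<^sub>R (v * v - v)"
          by (simp add: algebra_simps)
        moreover have "(x - c *\<^sub>R v) * y \<in> N" "(y - d *\<^sub>R v) * v \<in> N"
          using NB cd \<open>y \<in> B'\<close> B'B vB' by blast+
        ultimately have "x * y - (c * d) *\<^sub>R v \<in> N"
          using N(1) vv by (simp add: subspace_add subspace_scale)
        then show ?thesis using B' by blast
      qed
      define L where "L = U1 \<inter> B'"
      have L: "subspace L" unfolding L_def B'_def using sub by (simp add: subspace_inter)
      have "L = span (insert v K)"
      proof -
        have "x \<in> L \<longleftrightarrow> (\<exists>c. x - c *\<^sub>R v \<in> K)" for x
        proof -
          have "x \<in> U1 \<longleftrightarrow> x - c *\<^sub>R v \<in> U1" for c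
          proof
            assume "x - c *\<^sub>R v \<in> U1"
            then have "(x - c *\<^sub>R v) + c *\<^sub>R v \<in> U1"
              using sub(1) v by (intro subspace_add subspace_scale)
            then show "x \<in> U1" by simp
          qed (use sub(1) v in \<open>simp add: subspace_diff subspace_scale\<close>)
          then show ?thesis unfolding L_def K_def using B' by blast
        qed
        then show ?thesis using K by (auto simp: span_insert span_eq_iff[THEN iffD2])
      qed
      then have dL: "dim L = dim K + 1"
        using vN K unfolding K_def by (simp add: dim_insert span_eq_iff[THEN iffD2])
      obtain k' where k': "k' \<le> j" "weight_chain L k'" "j + dim L \<le> k' + dim U1"
        using weight_chain_restrict[OF ch sub(1) L] L_def by auto
      have "k' + dim L \<le> dim B'"
        using less.IH[OF _ k'(2) L _ _ multB'] k'(1) Suc by (auto simp: L_def B'_def)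
      then show ?thesis using 1 dB' dL dT k' Suc by linarith
    qed
  qed
qed

text \<open>With \<open>B\<close> the whole space, \<open>k\<close> is bounded both by
  \<open>dim U\<close> and by the codimension of \<open>U\<close>; the smaller of these is at most
  half their sum.\<close>

lemma weight_chain_le_half:
  assumes "weight_chain (U::(real^'n) set) k" "subspace U"
  shows "k \<le> CARD('n) div 2" "U = UNIV \<Longrightarrow> k = 0"
  using weight_chain_le_codim[OF assms subspace_UNIV] weight_chain_le_dim[OF assms]
  by auto

section \<open>Positive semidefinite matrices with range in a subspace\<close>

lemma sym_matsD: "X \<in> sym_mats \<Longrightarrow> x \<bullet> (X *v y) = (X *v x) \<bullet> y"
  by (metis (mono_tags, lifting) dot_lmul_matrix mem_Collect_eq sym_mats_def vector_transpose_matrix)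

lemma sym_mats_form: "X \<in> sym_mats \<Longrightarrow> x \<bullet> (X *v y) = y \<bullet> (X *v x)"
  by (metis sym_matsD inner_commute)

lemma sym_mats_iff: "X \<in> sym_mats \<longleftrightarrow> (\<forall>i j. X $ i $ j = X $ j $ i)"
  by (auto simp: sym_mats_def transpose_def vec_eq_iff)

lemma psd_coneD: "Y \<in> psd_cone \<Longrightarrow> Y \<in> sym_mats" "Y \<in> psd_cone \<Longrightarrow> 0 \<le> v \<bullet> (Y *v v)"
  by (auto simp: psd_cone_def)

lemma bilinear_mat: "bilinear (\<lambda>x y. x \<bullet> ((W::real^'m^'m) *v y))"
  unfolding bilinear_def
  by (intro conjI allI linearI)
    (simp_all add: inner_add_left inner_add_right matrix_vector_right_distrib matrix_vector_mult_scaleR)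

lemma mat_form_kernel:
  fixes W :: "real^'m^'m"
  assumes "W \<in> sym_mats" "subspace V" "\<And>v. v \<in> V \<Longrightarrow> 0 \<le> v \<bullet> (W *v v)"
    and "u \<in> V" "u \<bullet> (W *v u) = 0" "w \<in> V"
  shows "w \<bullet> (W *v u) = 0"
  using psd_bilinear_kernel[OF bilinear_mat sym_mats_form[OF assms(1)] assms(2,3), of u w] assms(4-6)
    sym_mats_form[OF assms(1), of u w] by simp

lemma subspace_mat_kernel:
  fixes W :: "real^'m^'m"
  assumes "W \<in> sym_mats" "subspace V" "\<And>v. v \<in> V \<Longrightarrow> 0 \<le> v \<bullet> (W *v v)"
  shows "subspace {v \<in> V. v \<bullet> (W *v v) = 0}"
  by (rule subspace_psd_kernel[OF bilinear_mat sym_mats_form[OF assms(1)] assms(2,3)])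

lemma psd_null:
  assumes "Y \<in> psd_cone" "u \<bullet> (Y *v u) = 0"
  shows "Y *v u = 0"
proof -
  have "(Y *v u) \<bullet> (Y *v u) = 0"
    using mat_form_kernel[OF psd_coneD(1)[OF assms(1)] subspace_UNIV psd_coneD(2)[OF assms(1)], of u "Y *v u"]
      assms(2) by simp
  then show ?thesis by simp
qed

lemma tr_inner_commute: "tr_inner X Y = tr_inner Y X"
  unfolding tr_inner_def by (rule trace_mul_sym)

lemma tr_inner_sum: "tr_inner X Y = (\<Sum>i\<in>UNIV. \<Sum>j\<in>UNIV. X $ i $ j * Y $ j $ i)"
  by (simp add: tr_inner_def trace_def matrix_matrix_mult_def)

lemma tr_inner_simps:
  "tr_inner X (Y + Z) = tr_inner X Y + tr_inner X Z"
  "tr_inner (Y + Z) X = tr_inner Y X + tr_inner Z X"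
  "tr_inner X (Y - Z) = tr_inner X Y - tr_inner X Z"
  "tr_inner (Y - Z) X = tr_inner Y X - tr_inner Z X"
  "tr_inner X (c *\<^sub>R Y) = c * tr_inner X Y"
  "tr_inner (c *\<^sub>R Y) X = c * tr_inner Y X"
  "tr_inner X 0 = 0"
  by (simp_all add: tr_inner_sum algebra_simps sum.distrib sum_subtractf sum_distrib_left)

definition outer :: "real^'m \<Rightarrow> real^'m^'m" where
  "outer v = (\<chi> i j. v $ i * v $ j)"

lemma outer_mult: "outer v *v z = (v \<bullet> z) *\<^sub>R v"
  by (simp add: outer_def vec_eq_iff matrix_vector_mult_def inner_vec_def sum_distrib_left
      sum_distrib_right mult_ac)

lemma outer_psd: "outer v \<in> psd_cone"
  by (auto simp: psd_cone_def outer_mult sym_mats_iff inner_commute) (simp add: outer_def)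

lemma tr_inner_outer: "tr_inner W (outer v) = v \<bullet> (W *v v)"
proof -
  have "tr_inner W (outer v) = (\<Sum>i\<in>UNIV. \<Sum>j\<in>UNIV. v $ i * (W $ i $ j * v $ j))"
    unfolding tr_inner_sum outer_def by (simp add: mult_ac)
  then show ?thesis
    by (simp add: inner_vec_def matrix_vector_mult_def sum_distrib_left)
qed

text \<open>For a subspace \<open>V\<close> this is a face of the cone. Describing faces by
  subspaces turns facial reduction into shrinking \<open>V\<close>.\<close>

definition psd_on :: "(real^'m) set \<Rightarrow> (real^'m^'m) set" where
  "psd_on V = {Y \<in> psd_cone. \<forall>z. Y *v z \<in> V}"

lemma psd_on_UNIV: "psd_on UNIV = psd_cone"
  by (simp add: psd_on_def)

lemma psd_on_mono: "V \<subseteq> V' \<Longrightarrow> psd_on V \<subseteq> psd_on V'"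
  by (auto simp: psd_on_def)

lemma outer_psd_on: "subspace V \<Longrightarrow> v \<in> V \<Longrightarrow> outer v \<in> psd_on V"
  by (simp add: psd_on_def outer_psd outer_mult subspace_scale)

text \<open>Induction on the rank: subtracting the outer product of the normalized vector
  \<open>Y *v z\<close> keeps the matrix semidefinite and puts \<open>z\<close> into its kernel. The
  range condition later places the summands in \<open>V\<close>.\<close>

lemma psd_decomposition:
  fixes Y :: "real^'m^'m"
  assumes "Y \<in> psd_cone"
  shows "\<exists>vs. Y = sum_list (map outer vs) \<and> set vs \<subseteq> range ((*v) Y)"
  using assms
proof (induction "dim (range ((*v) Y))" arbitrary: Y rule: less_induct)
  case less
  note sym = psd_coneD(1)[OF less.prems]
  show ?case
  proof (cases "\<forall>z. z \<bullet> (Y *v z) = 0")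
    case True
    then have "Y = 0"
      using psd_null[OF less.prems] by (metis matrix_eq matrix_vector_mult_0)
    then show ?thesis by (intro exI[of _ "[]"]) simp
  next
    case False
    then obtain z where z: "z \<bullet> (Y *v z) \<noteq> 0" by blast
    define c where "c = z \<bullet> (Y *v z)"
    have c: "c > 0" using z psd_coneD(2)[OF less.prems, of z] unfolding c_def by linarith
    define v where "v = (1 / sqrt c) *\<^sub>R (Y *v z)"
    have sub: "subspace (range ((*v) Y))"
      by (simp add: linear_subspace_image)
    have v: "v \<in> range ((*v) Y)"
      unfolding v_def using sub by (simp add: subspace_scale)
    define Y' where "Y' = Y - outer v"
    have Y'w: "Y' *v w = Y *v w - (v \<bullet> w) *\<^sub>R v" for w
      by (simp add: Y'_def matrix_vector_mult_diff_rdistrib outer_mult)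
    have vw: "(v \<bullet> w)\<^sup>2 = (w \<bullet> (Y *v z))\<^sup>2 / c" for w
      using c by (simp add: v_def power_divide inner_commute)
    have "Y' \<in> psd_cone"
      unfolding psd_cone_def
    proof (intro CollectI conjI allI)
      show "Y' \<in> sym_mats" using sym by (auto simp: Y'_def sym_mats_iff outer_def)
      fix w
      define b where "b = w \<bullet> (Y *v z)"
      have b': "z \<bullet> (Y *v w) = b" unfolding b_def by (rule sym_mats_form[OF sym])
      \<comment> \<open>Cauchy-Schwarz for the form of \<open>Y\<close>, obtained from its value at
        \<open>c *\<^sub>R w - b *\<^sub>R z\<close>.\<close>
      have "0 \<le> (c *\<^sub>R w - b *\<^sub>R z) \<bullet> (Y *v (c *\<^sub>R w - b *\<^sub>R z))"
        using psd_coneD(2)[OF less.prems] .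
      also have "\<dots> = c * (c * (w \<bullet> (Y *v w)) - b\<^sup>2)"
        using b' by (simp add: matrix_vector_mult_diff_distrib matrix_vector_mult_scaleR
            inner_diff_left inner_diff_right c_def[symmetric] b_def[symmetric]
            algebra_simps power2_eq_square)
      finally have "0 \<le> c * (w \<bullet> (Y *v w)) - b\<^sup>2"
        using c by (simp add: zero_le_mult_iff)
      then have "b\<^sup>2 / c \<le> w \<bullet> (Y *v w)" using c by (simp add: field_simps)
      then show "0 \<le> w \<bullet> (Y' *v w)"
        using vw[of w] by (simp add: Y'w inner_diff_right b_def inner_commute power2_eq_square)
    qed
    note Y' = this
    have le: "range ((*v) Y') \<subseteq> range ((*v) Y)"
    proof clarify
      fix w
      show "Y' *v w \<in> range ((*v) Y)"
        unfolding Y'w using sub v by (intro subspace_diff subspace_scale) auto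
    qed
    have "v \<bullet> z = sqrt c"
      using c by (simp add: v_def inner_commute c_def[symmetric] real_div_sqrt)
    then have "Y' *v z = 0"
      unfolding Y'w using c by (simp add: v_def)
    \<comment> \<open>The range of \<open>Y'\<close> is orthogonal to \<open>z\<close> but
      \<open>Y *v z\<close> is not, so the range strictly shrinks.\<close>
    then have "z \<bullet> (Y' *v w) = 0" for w
      using sym_matsD[OF psd_coneD(1)[OF Y'], of z w] by simp
    then have "Y *v z \<notin> range ((*v) Y')" using z by auto
    with le have "range ((*v) Y') \<subset> range ((*v) Y)" by auto
    then have "dim (range ((*v) Y')) < dim (range ((*v) Y))"
      using sub linear_subspace_image[OF matrix_vector_mul_linear subspace_UNIV, of Y']
      by (metis dim_psubset span_eq_iff)
    from less.hyps[OF this Y'] obtain vs where vs: "Y' = sum_list (map outer vs)"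
      "set vs \<subseteq> range ((*v) Y')" by blast
    then show ?thesis using le v
      by (intro exI[of _ "v # vs"]) (auto simp: Y'_def algebra_simps)
  qed
qed

lemma tr_inner_sum_list: "tr_inner W (sum_list (map outer vs)) = (\<Sum>v\<leftarrow>vs. v \<bullet> (W *v v))"
  by (induction vs) (simp_all add: tr_inner_simps tr_inner_outer)

lemma sum_list_outer_mult: "sum_list (map outer vs) *v z = (\<Sum>v\<leftarrow>vs. (v \<bullet> z) *\<^sub>R v)"
  by (induction vs) (simp_all add: matrix_vector_mult_add_rdistrib outer_mult)

lemma dual_cone_psd_on:
  assumes "W \<in> sym_mats" "\<And>v. v \<in> V \<Longrightarrow> 0 \<le> v \<bullet> (W *v v)"
  shows "W \<in> dual_cone (psd_on V)"
  unfolding dual_cone_def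
proof (intro CollectI conjI ballI assms(1))
  fix Y assume Y: "Y \<in> psd_on V"
  then obtain vs where vs: "Y = sum_list (map outer vs)" "set vs \<subseteq> range ((*v) Y)"
    using psd_decomposition unfolding psd_on_def by blast
  then have "set vs \<subseteq> V" using Y unfolding psd_on_def by blast
  then have "0 \<le> (\<Sum>v\<leftarrow>vs. v \<bullet> (W *v v))"
    using assms(2) by (intro sum_list_nonneg) auto
  then show "0 \<le> tr_inner W Y" by (simp add: vs(1) tr_inner_sum_list)
qed

text \<open>Write \<open>Y\<close> as a sum of outer products of vectors of \<open>V\<close>. Its
  trace product with \<open>W\<close> is a sum of nonnegative values of the form of
  \<open>W\<close>, so it is zero only if every summand is isotropic.\<close>

lemma psd_on_Int_perp:
  assumes W: "W \<in> sym_mats" "\<And>v. v \<in> V \<Longrightarrow> 0 \<le> v \<bullet> (W *v v)" and V: "subspace V"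
  shows "psd_on V \<inter> perp {W} = psd_on {v \<in> V. v \<bullet> (W *v v) = 0}"
    (is "_ = psd_on ?V'")
proof (intro equalityI subsetI)
  note sub = subspace_mat_kernel[OF W(1) V W(2)]
  fix Y assume Y: "Y \<in> psd_on V \<inter> perp {W}"
  then obtain vs where vs: "Y = sum_list (map outer vs)" "set vs \<subseteq> range ((*v) Y)"
    using psd_decomposition unfolding psd_on_def by blast
  then have sV: "set vs \<subseteq> V" using Y unfolding psd_on_def by blast
  have "(\<Sum>v\<leftarrow>vs. v \<bullet> (W *v v)) = 0"
    using Y tr_inner_commute[of Y W] by (simp add: perp_def vs(1)[symmetric] tr_inner_sum_list[symmetric])
  then have "\<forall>x\<in>set (map (\<lambda>v. v \<bullet> (W *v v)) vs). x = 0"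
    using W(2) sV by (subst sum_list_nonneg_eq_0_iff[symmetric]) auto
  then have sV': "set vs \<subseteq> ?V'" using sV by auto
  have "Y *v z \<in> ?V'" for z
    unfolding vs(1) sum_list_outer_mult using sV'
  proof (induction vs)
    case Nil
    then show ?case using subspace_0[OF sub] by simp
  next
    case (Cons a vs)
    then have "a \<in> ?V'" "(\<Sum>v\<leftarrow>vs. (v \<bullet> z) *\<^sub>R v) \<in> ?V'" by auto
    then have "(a \<bullet> z) *\<^sub>R a + (\<Sum>v\<leftarrow>vs. (v \<bullet> z) *\<^sub>R v) \<in> ?V'"
      by (intro subspace_add[OF sub] subspace_scale[OF sub])
    then show ?case by (simp only: list.map sum_list.Cons)
  qed
  then show "Y \<in> psd_on ?V'" using Y by (auto simp: psd_on_def)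
next
  fix Y assume Y: "Y \<in> psd_on ?V'"
  then obtain vs where vs: "Y = sum_list (map outer vs)" "set vs \<subseteq> range ((*v) Y)"
    using psd_decomposition unfolding psd_on_def by blast
  then have sV: "set vs \<subseteq> ?V'" using Y unfolding psd_on_def by blast
  then have "(\<Sum>v\<leftarrow>vs. v \<bullet> (W *v v)) = 0"
    by (induction vs) auto
  then have "tr_inner Y W = 0"
    using tr_inner_commute[of Y W] by (simp add: vs(1) tr_inner_sum_list)
  then show "Y \<in> psd_on V \<inter> perp {W}"
    using Y by (auto simp: psd_on_def perp_def dest: psd_coneD)
qed

lemma not_perp_psd_on:
  assumes "subspace V" "v \<in> V" "v \<bullet> (W *v v) \<noteq> 0"
  shows "W \<notin> perp (psd_on V)"
  using outer_psd_on[OF assms(1,2)] assms(3) tr_inner_outer[of W v] unfolding perp_def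
  by (metis (mono_tags, lifting) mem_Collect_eq)

lemma dual_cone_psd_onD:
  assumes "W \<in> dual_cone F" "psd_on V \<subseteq> F" "subspace V" "v \<in> V"
  shows "0 \<le> v \<bullet> (W *v v)"
  using assms outer_psd_on[OF assms(3,4)] by (auto simp: dual_cone_def tr_inner_outer[symmetric])

text \<open>For semidefinite \<open>Y\<close>, the hypothesis puts the orthogonal complement of
  \<open>V\<close> into the kernel, and by symmetry the range into \<open>V\<close>. Using only the
  scalars \<open>u \<bullet> (Y *v u)\<close> suits face arguments, where these add along
  segments.\<close>

lemma psd_onI:
  fixes Y :: "real^'m^'m"
  assumes "subspace V" "Y \<in> psd_cone"
    and u: "\<And>u. (\<And>v. v \<in> V \<Longrightarrow> u \<bullet> v = 0) \<Longrightarrow> u \<bullet> (Y *v u) = 0"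
  shows "Y \<in> psd_on V"
proof -
  obtain P where P: "linear P" "\<And>x. P x \<in> V" "\<And>x b. b \<in> V \<Longrightarrow> (x - P x) \<bullet> b = 0"
    using orth_projection_exists[OF assms(1)] by blast
  have "Y *v z \<in> V" for z
  proof -
    define w where "w = Y *v z - P (Y *v z)"
    have "Y *v w = 0"
      using psd_null[OF assms(2) u] P(3) unfolding w_def by blast
    then have "w \<bullet> (Y *v z) = 0" using sym_matsD[OF psd_coneD(1)[OF assms(2)], of w z] by simp
    moreover have "w \<bullet> P (Y *v z) = 0" unfolding w_def by (rule P(3)[OF P(2)])
    ultimately have "w \<bullet> w = 0" by (simp add: w_def inner_diff_right)
    then have "w = 0" by simp
    then have "Y *v z = P (Y *v z)" by (simp add: w_def)
    then show ?thesis using P(2) by metis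
  qed
  then show ?thesis using assms(2) by (simp add: psd_on_def)
qed

lemma psd_on_perp_kernel:
  assumes "X \<in> psd_on V" "\<And>v. v \<in> V \<Longrightarrow> u \<bullet> v = 0"
  shows "X *v u = 0"
  using assms by (intro psd_null) (auto simp: psd_on_def)

lemma sym_mats_add: "X \<in> sym_mats \<Longrightarrow> Y \<in> sym_mats \<Longrightarrow> X + Y \<in> sym_mats"
  and sym_mats_diff: "X \<in> sym_mats \<Longrightarrow> Y \<in> sym_mats \<Longrightarrow> X - Y \<in> sym_mats"
  and sym_mats_scaleR: "X \<in> sym_mats \<Longrightarrow> c *\<^sub>R X \<in> sym_mats"
  unfolding sym_mats_iff by simp_all

lemma psd_cone_add: "X \<in> psd_cone \<Longrightarrow> Y \<in> psd_cone \<Longrightarrow> X + Y \<in> psd_cone"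
  and psd_cone_scaleR: "X \<in> psd_cone \<Longrightarrow> 0 \<le> c \<Longrightarrow> c *\<^sub>R X \<in> psd_cone"
  unfolding psd_cone_def
  by (auto simp: sym_mats_add sym_mats_scaleR matrix_vector_mult_add_rdistrib inner_add_right
      scaleR_matrix_vector_assoc[symmetric])

lemma psd_on_add: "subspace V \<Longrightarrow> X \<in> psd_on V \<Longrightarrow> Y \<in> psd_on V \<Longrightarrow> X + Y \<in> psd_on V"
  and psd_on_scaleR: "subspace V \<Longrightarrow> X \<in> psd_on V \<Longrightarrow> 0 \<le> c \<Longrightarrow> c *\<^sub>R X \<in> psd_on V"
  unfolding psd_on_def
  by (auto simp: psd_cone_add psd_cone_scaleR matrix_vector_mult_add_rdistrib subspace_add
      subspace_scale scaleR_matrix_vector_assoc[symmetric])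

lemma face_psd_on:
  assumes V: "subspace V"
  shows "psd_on V face_of psd_cone"
  unfolding face_of_def
proof (intro conjI ballI impI)
  show "psd_on V \<subseteq> psd_cone" by (auto simp: psd_on_def)
  show "convex (psd_on V)"
    by (rule convexI) (intro psd_on_add psd_on_scaleR V; simp)
  have *: "a \<in> psd_on V" if a: "a \<in> psd_cone" and b: "b \<in> psd_cone" and x: "x \<in> psd_on V"
    and t: "0 < s" "0 < t" "x = s *\<^sub>R a + t *\<^sub>R b" for a b x and s t :: real
  proof (rule psd_onI[OF V a])
    fix u assume u: "\<And>v. v \<in> V \<Longrightarrow> u \<bullet> v = 0"
    have "0 = u \<bullet> (x *v u)" using u x by (simp add: psd_on_def)
    also have "\<dots> = s * (u \<bullet> (a *v u)) + t * (u \<bullet> (b *v u))"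
      by (simp add: t(3) matrix_vector_mult_add_rdistrib inner_add_right
          scaleR_matrix_vector_assoc[symmetric])
    finally show "u \<bullet> (a *v u) = 0"
      using t(1,2) psd_coneD(2)[OF a, of u] psd_coneD(2)[OF b, of u]
      by (smt (verit) mult_nonneg_nonneg mult_pos_pos)
  qed
  fix a b x assume ab: "a \<in> psd_cone" "b \<in> psd_cone" "x \<in> psd_on V" "x \<in> open_segment a b"
  then obtain u where "0 < u" "u < 1" "x = (1 - u) *\<^sub>R a + u *\<^sub>R b"
    by (auto simp: in_segment)
  then show "a \<in> psd_on V" "b \<in> psd_on V"
    using *[OF ab(1,2,3), of "1 - u" u] *[OF ab(2,1,3), of u "1 - u"] by (auto simp: add.commute)
qed

lemma min_face_subset:
  "F face_of psd_cone \<Longrightarrow> L \<inter> psd_cone \<subseteq> F \<Longrightarrow> min_face L \<subseteq> F"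
  unfolding min_face_def by blast

text \<open>\<open>Y\<close> is a relative interior point of \<open>psd_on V\<close>: for every
  \<open>Z\<close> there, the segment from \<open>Z\<close> through \<open>Y\<close> can be
  prolonged within the cone, so each face containing \<open>Y\<close> contains
  \<open>Z\<close>.\<close>

lemma psd_on_subset_min_face:
  fixes Y :: "real^'m^'m"
  assumes V: "subspace V" and Y: "Y \<in> L" "Y \<in> psd_on V"
    and pos: "\<And>v. v \<in> V \<Longrightarrow> v \<noteq> 0 \<Longrightarrow> 0 < v \<bullet> (Y *v v)"
  shows "psd_on V \<subseteq> min_face L"
proof
  fix Z assume Z: "Z \<in> psd_on V"
  have Yp: "Y \<in> psd_cone" and Zp: "Z \<in> psd_cone" using Y Z by (auto simp: psd_on_def)
  obtain P where P: "linear P" "\<And>x. P x \<in> V" "\<And>x b. b \<in> V \<Longrightarrow> (x - P x) \<bullet> b = 0"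
    using orth_projection_exists[OF V] by blast
  \<comment> \<open>Compactness of the unit sphere of \<open>V\<close> gives a uniform
    \<open>e\<close> with \<open>Y - e *\<^sub>R Z\<close> nonnegative on \<open>V\<close>.\<close>
  define S where "S = sphere 0 1 \<inter> V"
  have S: "compact S"
    unfolding S_def by (intro compact_Int_closed compact_sphere closed_subspace V)
  have cont: "continuous_on S (\<lambda>v. v \<bullet> (M *v v))" for M :: "real^'m^'m"
    by (intro continuous_intros linear_continuous_on_compose[OF _ matrix_vector_mul_linear])
  have "\<exists>e>0. \<forall>v\<in>S. e * (v \<bullet> (Z *v v)) \<le> v \<bullet> (Y *v v)"
  proof (cases "S = {}")
    case True
    then show ?thesis by (intro exI[of _ 1]) simp
  next
    case False
    obtain a where a: "a \<in> S" "\<And>v. v \<in> S \<Longrightarrow> a \<bullet> (Y *v a) \<le> v \<bullet> (Y *v v)"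
      using continuous_attains_inf[OF S False cont[of Y]] by blast
    obtain b where b: "b \<in> S" "\<And>v. v \<in> S \<Longrightarrow> v \<bullet> (Z *v v) \<le> b \<bullet> (Z *v b)"
      using continuous_attains_sup[OF S False cont[of Z]] by blast
    have ap: "0 < a \<bullet> (Y *v a)" using a(1) unfolding S_def by (intro pos) auto
    have bp: "0 \<le> b \<bullet> (Z *v b)" by (rule psd_coneD(2)[OF Zp])
    \<comment> \<open>The summand 1 guards against \<open>b \<bullet> (Z *v b) = 0\<close>.\<close>
    define e where "e = a \<bullet> (Y *v a) / (b \<bullet> (Z *v b) + 1)"
    have e: "e > 0" unfolding e_def using ap bp by simp
    have "e * (v \<bullet> (Z *v v)) \<le> v \<bullet> (Y *v v)" if "v \<in> S" for v
    proof -
      have "e * (v \<bullet> (Z *v v)) \<le> e * (b \<bullet> (Z *v b) + 1)"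
        using e b(2)[OF that] by (intro mult_left_mono) auto
      also have "\<dots> = a \<bullet> (Y *v a)" unfolding e_def using bp by simp
      finally show ?thesis using a(2)[OF that] by simp
    qed
    then show ?thesis using e by blast
  qed
  then obtain e where e: "e > 0" "\<And>v. v \<in> S \<Longrightarrow> e * (v \<bullet> (Z *v v)) \<le> v \<bullet> (Y *v v)" by blast
  have eV: "e * (v \<bullet> (Z *v v)) \<le> v \<bullet> (Y *v v)" if v: "v \<in> V" for v
  proof (cases "v = 0")
    case False
    define w where "w = (1 / norm v) *\<^sub>R v"
    have "w \<in> S" unfolding S_def w_def using False V v by (simp add: subspace_scale)
    from e(2)[OF this] show ?thesis
      using False by (simp add: w_def matrix_vector_mult_scaleR field_simps)
  qed simp
  have form_P: "v \<bullet> (X *v v) = P v \<bullet> (X *v P v)" if X: "X \<in> psd_on V" for X v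
  proof -
    define u where "u = v - P v"
    have u: "u \<bullet> (X *v z) = 0" for z
      unfolding u_def using X by (intro P(3)) (simp add: psd_on_def)
    have "X *v u = 0"
      unfolding u_def by (rule psd_on_perp_kernel[OF X P(3)])
    moreover have "v = P v + u" by (simp add: u_def)
    ultimately show ?thesis using u
      by (metis add.right_neutral inner_add_left matrix_vector_right_distrib)
  qed
  have D: "Y - e *\<^sub>R Z \<in> psd_cone"
    unfolding psd_cone_def
  proof (intro CollectI conjI allI)
    show "Y - e *\<^sub>R Z \<in> sym_mats"
      using psd_coneD(1)[OF Yp] psd_coneD(1)[OF Zp] by (simp add: sym_mats_diff sym_mats_scaleR)
    fix v
    show "0 \<le> v \<bullet> ((Y - e *\<^sub>R Z) *v v)"
      using eV[OF P(2)[of v]] form_P[OF Y(2), of v] form_P[OF Z, of v]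
      by (simp add: matrix_vector_mult_diff_rdistrib scaleR_matrix_vector_assoc[symmetric] inner_diff_right)
  qed
  show "Z \<in> min_face L"
    unfolding min_face_def
  proof clarify
    fix F assume F: "F face_of psd_cone" "L \<inter> psd_cone \<subseteq> F"
    have YF: "Y \<in> F" using F(2) Y(1) Yp by blast
    \<comment> \<open>\<open>A\<close> is the prolonged end point, scaled so that \<open>Y\<close>
      is the convex combination of \<open>A\<close> and \<open>Z\<close> with weight
      \<open>t\<close> on \<open>Z\<close>.\<close>
    define t where "t = e / (1 + e)"
    define A where "A = (1 + e) *\<^sub>R (Y - t *\<^sub>R Z)"
    have t: "0 < t" "t < 1" using e(1) by (auto simp: t_def)
    have "Y - t *\<^sub>R Z = (1 / (1 + e)) *\<^sub>R (Y - e *\<^sub>R Z) + t *\<^sub>R Y"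
      unfolding vec_eq_iff using e(1) by (simp add: t_def divide_simps) (simp add: algebra_simps)
    then have "Y - t *\<^sub>R Z \<in> psd_cone"
      using D Yp e(1) t by (simp add: psd_cone_add psd_cone_scaleR)
    then have A: "A \<in> psd_cone" unfolding A_def using e(1) by (simp add: psd_cone_scaleR)
    have "1 - t = 1 / (1 + e)" using e(1) by (simp add: t_def field_simps)
    then have "(1 - t) *\<^sub>R A = Y - t *\<^sub>R Z"
      using e(1) by (simp add: A_def)
    then have Yt: "Y = (1 - t) *\<^sub>R A + t *\<^sub>R Z" by simp
    show "Z \<in> F"
    proof (cases "A = Z")
      case True
      then have "Y = Z" using Yt by (simp add: scaleR_left_distrib[symmetric])
      then show ?thesis using YF by simp
    next
      case False
      then have "Y \<in> open_segment A Z" using Yt t by (auto simp: in_segment)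
      then show ?thesis using F(1) A Zp YF unfolding face_of_def by blast
    qed
  qed
qed

text \<open>The subspace of pairs \<open>(D y, f y)\<close> misses \<open>(0, 1)\<close>. The
  component \<open>w\<close> of \<open>(0, 1)\<close> normal to it has nonzero last coordinate, and
  solving \<open>w \<bullet> (D y, f y) = 0\<close> for \<open>f y\<close> gives
  \<open>l\<close>.\<close>

lemma linear_factor:
  fixes f :: "'a::euclidean_space \<Rightarrow> real" and D :: "'a \<Rightarrow> 'b::euclidean_space"
  assumes "linear f" "linear D" "subspace E" "\<And>y. y \<in> E \<Longrightarrow> D y = 0 \<Longrightarrow> f y = 0"
  shows "\<exists>l. \<forall>y\<in>E. f y = l \<bullet> D y"
proof -
  define G where "G = (\<lambda>y. (D y, f y)) ` E"
  have "linear (\<lambda>y. (D y, f y))"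
    using assms(1,2) by (simp add: linear_iff)
  then have G: "subspace G" unfolding G_def using assms(3) by (rule linear_subspace_image)
  have n: "(0, 1) \<notin> G" unfolding G_def using assms(4) by fastforce
  obtain P where P: "linear P" "\<And>x. P x \<in> G" "\<And>x b. b \<in> G \<Longrightarrow> (x - P x) \<bullet> b = 0"
    using orth_projection_exists[OF G] by blast
  define w where "w = (0, 1) - P (0, 1)"
  have "w \<noteq> 0" unfolding w_def using n P(2)[of "(0,1)"] by auto
  have wG: "w \<bullet> g = 0" if "g \<in> G" for g unfolding w_def by (rule P(3)[OF that])
  have "w \<bullet> w = w \<bullet> (0, 1) - w \<bullet> P (0, 1)" unfolding w_def by (simp add: inner_diff_right)
  then have "w \<bullet> w = snd w" using wG[OF P(2)] by (cases w) simp
  then have s: "snd w \<noteq> 0" using \<open>w \<noteq> 0\<close> by auto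
  have "f y = ((- 1 / snd w) *\<^sub>R fst w) \<bullet> D y" if "y \<in> E" for y
  proof -
    have "fst w \<bullet> D y + snd w * f y = 0"
      using wG[of "(D y, f y)"] that unfolding G_def by (cases w) auto
    then show ?thesis using s by (simp add: field_simps)
  qed
  then show ?thesis by blast
qed

section \<open>The forms orthogonal to the relaxation\<close>

definition diag_gap :: "real^('n option)^('n option) \<Rightarrow> real^'n" where
  "diag_gap Y = (\<chi> i. Y $ Some i $ Some i - Y $ None $ Some i)"

text \<open>The symmetric matrix of the quadratic form with terms
  \<open>l i * (x i * x i - x0 * x i)\<close>; the mixed coefficient is split into two
  halves.\<close>

definition gap_form :: "real^'n \<Rightarrow> real^('n option)^('n option)" where
  "gap_form l = (\<chi> a b. case a of
     None \<Rightarrow> (case b of None \<Rightarrow> 0 | Some j \<Rightarrow> - l $ j / 2)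
   | Some i \<Rightarrow> (case b of None \<Rightarrow> - l $ i / 2 | Some j \<Rightarrow> if i = j then l $ i else 0))"

lemma gap_form_sym: "gap_form l \<in> sym_mats"
  by (auto simp: sym_mats_iff gap_form_def split: option.splits)

lemma linear_diag_gap: "linear diag_gap"
  by (rule linearI) (simp_all add: diag_gap_def vec_eq_iff algebra_simps)

lemma tr_inner_gap_form:
  fixes l :: "real^'n::finite"
  assumes "Y \<in> sym_mats"
  shows "tr_inner (gap_form l) Y = l \<bullet> diag_gap Y"
proof -
  have s: "Y $ Some i $ None = Y $ None $ Some i" for i
    using assms by (simp add: sym_mats_iff)
  have inner: "(\<Sum>j\<in>UNIV. (if i = j then l $ i else 0) * Y $ Some j $ Some i) = l $ i * Y $ Some i $ Some i" for i
    by (simp add: if_distrib[of "\<lambda>x. x * _"] cong: if_cong)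
  have "tr_inner (gap_form l) Y = (\<Sum>j\<in>UNIV. - l $ j / 2 * Y $ Some j $ None) +
      (\<Sum>i\<in>UNIV. - l $ i / 2 * Y $ None $ Some i + (\<Sum>j\<in>UNIV. (if i = j then l $ i else 0) * Y $ Some j $ Some i))"
    unfolding tr_inner_sum sum_option gap_form_def by simp
  also have "\<dots> = (\<Sum>j\<in>UNIV. - l $ j / 2 * Y $ Some j $ None) +
      (\<Sum>i\<in>UNIV. - l $ i / 2 * Y $ None $ Some i + l $ i * Y $ Some i $ Some i)"
    by (simp only: inner)
  finally show ?thesis
    unfolding inner_vec_def diag_gap_def
    by (simp add: s sum.distrib[symmetric] algebra_simps)
qed

lemma gap_form_eval:
  fixes l :: "real^'n::finite"
  shows "v \<bullet> (gap_form l *v v) = (\<Sum>i\<in>UNIV. l $ i * (v $ Some i * v $ Some i - v $ None * v $ Some i))"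
  using tr_inner_gap_form[OF psd_coneD(1)[OF outer_psd[of v]], of l] unfolding tr_inner_outer
  by (simp add: inner_vec_def diag_gap_def outer_def)

definition feasible_space :: "nat \<Rightarrow> (nat \<Rightarrow> real^'n) \<Rightarrow> (nat \<Rightarrow> real) \<Rightarrow> (real^'n option) set" where
  "feasible_space q A b = {v. \<forall>k<q. homog_row A b k \<bullet> v = 0}"

lemma subspace_feasible_space: "subspace (feasible_space q A b)"
  by (auto simp: subspace_def feasible_space_def inner_add_right)

lemma rlt_affine_iff:
  "Y \<in> rlt_affine q A b \<longleftrightarrow>
     Y \<in> sym_mats \<and> Y $ None $ None = 1 \<and> diag_gap Y = 0 \<and> (\<forall>z. Y *v z \<in> feasible_space q A b)"
proof -
  have "homog_row A b k v* Y = 0 \<longleftrightarrow> (\<forall>z. homog_row A b k \<bullet> (Y *v z) = 0)" for k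
    by (metis dot_lmul_matrix inner_eq_zero_iff inner_zero_left)
  then show ?thesis
    by (auto simp: rlt_affine_def diag_gap_def vec_eq_iff feasible_space_def)
qed

lemma rlt_Int_psd_subset: "rlt_affine q A b \<inter> psd_cone \<subseteq> psd_on (feasible_space q A b)"
  by (auto simp: rlt_affine_iff psd_on_def)

lemma gap_form_perp: "gap_form l \<in> perp (rlt_affine q A b)"
  by (simp add: perp_def gap_form_sym tr_inner_gap_form rlt_affine_iff)

lemma outer_rlt_affine:
  assumes "p $ None = 1" "\<And>i. p $ Some i \<in> {0, 1}" "p \<in> feasible_space q A b"
  shows "outer p \<in> rlt_affine q A b"
  unfolding rlt_affine_iff
proof (intro conjI allI)
  show "outer p \<in> sym_mats" by (rule psd_coneD(1)[OF outer_psd])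
  show "outer p $ None $ None = 1" using assms(1) by (simp add: outer_def)
  show "diag_gap (outer p) = 0"
    unfolding vec_eq_iff
  proof
    fix i
    show "diag_gap (outer p) $ i = 0 $ i"
      using assms(1) assms(2)[of i] by (auto simp: diag_gap_def outer_def)
  qed
  show "outer p *v z \<in> feasible_space q A b" for z
    using assms(3) by (simp add: outer_mult subspace_scale[OF subspace_feasible_space])
qed

lemma orth_projection_matrix:
  fixes V :: "(real^'m) set"
  assumes "subspace V"
  obtains P :: "real^'m^'m" where "P \<in> sym_mats" "\<And>x. P *v x \<in> V"
    "\<And>x b. b \<in> V \<Longrightarrow> (x - P *v x) \<bullet> b = 0" "\<And>v. v \<in> V \<Longrightarrow> P *v v = v"
    "\<And>v. v \<bullet> (P *v v) = (P *v v) \<bullet> (P *v v)"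
proof -
  obtain P where P: "linear P" "\<And>x. P x \<in> V" "\<And>x b. b \<in> V \<Longrightarrow> (x - P x) \<bullet> b = 0"
    using orth_projection_exists[OF assms] by blast
  have m: "matrix P *v x = P x" for x using P(1) by (simp add: matrix_works)
  have xy: "x \<bullet> P y = P x \<bullet> P y" for x y using P(3)[OF P(2), of x y] by (simp add: inner_diff_left)
  show thesis
  proof
    show "matrix P \<in> sym_mats"
      unfolding sym_mats_iff
    proof (intro allI)
      fix i j
      have "axis i 1 \<bullet> P (axis j 1) = axis j 1 \<bullet> P (axis i 1)"
        using xy by (metis inner_commute)
      then show "matrix P $ i $ j = matrix P $ j $ i"
        by (simp add: matrix_def inner_axis' )
    qed
    show "matrix P *v x \<in> V" for x using m P(2) by simp
    show "(x - matrix P *v x) \<bullet> b = 0" if "b \<in> V" for x b using m P(3) that by simp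
    show "matrix P *v v = v" if "v \<in> V" for v
    proof -
      have "v - P v \<in> V" using that P(2) assms by (simp add: subspace_diff)
      from P(3)[OF this, of v] show ?thesis by (simp add: m)
    qed
    show "v \<bullet> (matrix P *v v) = (matrix P *v v) \<bullet> (matrix P *v v)" for v
      using xy m by simp
  qed
qed

text \<open>A form that is nonnegative on the range subspace extends to one that is positive
  semidefinite everywhere, without leaving \<open>L\<^sup>\<bottom>\<close>: the first reduction step can be combined with
  the restriction to the range subspace.\<close>

lemma initial_reduction:
  fixes A :: "nat \<Rightarrow> real^'n::finite" and b :: "nat \<Rightarrow> real" and q :: nat
  defines "V \<equiv> feasible_space q A b"
  assumes ne: "V \<noteq> UNIV" and l: "\<And>v. v \<in> V \<Longrightarrow> 0 \<le> v \<bullet> (gap_form l *v v)"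
  shows "\<exists>W \<in> perp (rlt_affine q A b) \<inter> (dual_cone psd_cone - perp psd_cone).
           psd_cone \<inter> perp {W} = psd_on {v \<in> V. v \<bullet> (gap_form l *v v) = 0}"
proof -
  have V: "subspace V" unfolding V_def by (rule subspace_feasible_space)
  obtain P where P: "P \<in> sym_mats" "\<And>x. P *v x \<in> V"
    "\<And>x b. b \<in> V \<Longrightarrow> (x - P *v x) \<bullet> b = 0" "\<And>v. v \<in> V \<Longrightarrow> P *v v = v"
    "\<And>v. v \<bullet> (P *v v) = (P *v v) \<bullet> (P *v v)"
    using orth_projection_matrix[OF V] by metis
  define Q where "Q = gap_form l"
  have tP: "transpose P = P" and tQ: "transpose Q = Q"
    using P(1) gap_form_sym unfolding Q_def sym_mats_def by auto
  \<comment> \<open>The first term extends the form through the projection; the form of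
    \<open>mat 1 - P\<close> is positive exactly off \<open>V\<close>. Multiplying
    \<open>mat 1 - P\<close> by a matrix with range in \<open>V\<close> gives zero, so adding it
    keeps \<open>W\<close> orthogonal to the relaxation.\<close>
  define W where "W = P ** (Q ** P) + (mat 1 - P)"
  have Wv: "W *v v = P *v (Q *v (P *v v)) + (v - P *v v)" for v
    by (simp add: W_def matrix_vector_mult_add_rdistrib matrix_vector_mult_diff_rdistrib
        matrix_vector_mul_assoc[symmetric])
  have form: "v \<bullet> (W *v v) = (P *v v) \<bullet> (Q *v (P *v v)) + (v - P *v v) \<bullet> (v - P *v v)" for v
    using sym_matsD[OF P(1), of v "Q *v (P *v v)"] P(3)[OF P(2), of v v]
    by (simp add: Wv inner_add_right inner_diff_right inner_diff_left inner_commute)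
  have pos: "0 \<le> v \<bullet> (W *v v)" for v
    unfolding form using l[OF P(2)] by (simp add: Q_def)
  have sym: "W \<in> sym_mats"
  proof -
    have "P ** (Q ** P) \<in> sym_mats"
      unfolding sym_mats_def by (simp add: matrix_transpose_mul tP tQ matrix_mul_assoc)
    moreover have "mat 1 \<in> sym_mats" by (simp add: sym_mats_def)
    ultimately show ?thesis unfolding W_def using P(1) by (intro sym_mats_add sym_mats_diff)
  qed
  have ker: "v \<bullet> (W *v v) = 0 \<longleftrightarrow> v \<in> V \<and> v \<bullet> (Q *v v) = 0" for v
  proof
    assume "v \<bullet> (W *v v) = 0"
    then have 0: "(P *v v) \<bullet> (Q *v (P *v v)) = 0" "(v - P *v v) \<bullet> (v - P *v v) = 0"
      unfolding form using l[OF P(2), of v] inner_ge_zero[of "v - P *v v"]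
      unfolding Q_def by linarith+
    then have "v = P *v v" by simp
    then show "v \<in> V \<and> v \<bullet> (Q *v v) = 0" using 0(1) P(2) by metis
  next
    assume "v \<in> V \<and> v \<bullet> (Q *v v) = 0"
    then show "v \<bullet> (W *v v) = 0" unfolding form using P(4) by simp
  qed
  obtain v where v: "v \<notin> V" using ne by blast
  have "W \<in> dual_cone psd_cone"
    using dual_cone_psd_on[OF sym, of UNIV] pos by (simp add: psd_on_UNIV)
  moreover have "W \<notin> perp psd_cone"
    using not_perp_psd_on[OF subspace_UNIV, of v W] v ker by (auto simp: psd_on_UNIV)
  moreover have "psd_cone \<inter> perp {W} = psd_on {v \<in> V. v \<bullet> (Q *v v) = 0}"
    using psd_on_Int_perp[OF sym _ subspace_UNIV] pos ker by (simp add: psd_on_UNIV)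
  moreover have "W \<in> perp (rlt_affine q A b)"
    unfolding perp_def
  proof (intro CollectI conjI ballI sym)
    fix Y assume Y: "Y \<in> rlt_affine q A b"
    have PY: "P ** Y = Y"
      unfolding matrix_eq using Y P(4) by (simp add: rlt_affine_iff V_def matrix_vector_mul_assoc[symmetric])
    have tY: "transpose Y = Y" using Y by (simp add: rlt_affine_iff sym_mats_def)
    have YP: "Y ** P = Y" using PY tY tP by (metis matrix_transpose_mul)
    have "tr_inner (P ** (Q ** P)) Y = trace (P ** (Q ** (P ** Y)))"
      by (simp add: tr_inner_def matrix_mul_assoc)
    also have "\<dots> = trace (Q ** (Y ** P))"
      by (subst trace_mul_sym) (simp add: PY matrix_mul_assoc)
    also have "\<dots> = 0"
      using gap_form_perp[of l q A b] Y by (simp add: YP Q_def perp_def tr_inner_def)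
    finally have 1: "tr_inner (P ** (Q ** P)) Y = 0" .
    have "(mat 1 - P) ** Y = 0"
      unfolding matrix_eq using PY
      by (simp add: matrix_vector_mul_assoc[symmetric] matrix_vector_mult_diff_rdistrib)
        (simp add: matrix_vector_mul_assoc)
    then have "tr_inner (mat 1 - P) Y = 0" by (simp add: tr_inner_def trace_def)
    then show "tr_inner W Y = 0"
      using 1 by (simp only: W_def tr_inner_simps)
  qed
  ultimately show ?thesis unfolding Q_def by blast
qed

text \<open>On the space \<open>E\<close> of symmetric matrices with range in the feasible space,
  \<open>W\<close> annihilates the kernel of \<open>diag_gap\<close>, so its trace product factors
  through \<open>diag_gap\<close>. Outer products of feasible vectors lie in \<open>E\<close> and
  turn this into an identity of forms.\<close>

lemma perp_rlt_affine_form: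
  fixes A :: "nat \<Rightarrow> real^'n::finite" and b :: "nat \<Rightarrow> real" and q :: nat
  assumes "rlt_affine q A b \<noteq> {}" "W \<in> perp (rlt_affine q A b)"
  shows "\<exists>l. \<forall>v\<in>feasible_space q A b. v \<bullet> (W *v v) = v \<bullet> (gap_form l *v v)"
proof -
  let ?V = "feasible_space q A b"
  note V = subspace_feasible_space[of q A b]
  obtain Y0 where Y0: "Y0 \<in> rlt_affine q A b" using assms(1) by blast
  have W: "tr_inner W Y = 0" if "Y \<in> rlt_affine q A b" for Y
    using assms(2) that by (simp add: perp_def)
  define E where "E = {Y \<in> sym_mats. \<forall>z. Y *v z \<in> ?V}"
  have E: "subspace E"
    unfolding subspace_def E_def
    by (auto simp: sym_mats_add sym_mats_scaleR matrix_vector_mult_add_rdistrib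
        scaleR_matrix_vector_assoc[symmetric] subspace_0[OF V] intro!: subspace_add[OF V] subspace_scale[OF V])
       (simp add: sym_mats_iff)
  have Y0E: "Y0 \<in> E" and Y00: "Y0 $ None $ None = 1" "diag_gap Y0 = 0"
    using Y0 by (auto simp: E_def rlt_affine_iff)
  have lin: "linear (tr_inner W)" by (rule linearI) (simp_all add: tr_inner_simps)
  have "tr_inner W Y = 0" if Y: "Y \<in> E" "diag_gap Y = 0" for Y
  proof -
    \<comment> \<open>The multiple of \<open>Y0\<close> is subtracted to keep the corner entry equal
      to 1, so that \<open>Z\<close> lies in the affine space.\<close>
    define Z where "Z = Y0 + (Y - Y $ None $ None *\<^sub>R Y0)"
    have "Z \<in> E" unfolding Z_def using E Y(1) Y0E by (simp add: subspace_add subspace_diff subspace_scale)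
    moreover have "diag_gap Z = 0"
      unfolding Z_def using Y(2) Y00(2)
      by (simp add: linear_add[OF linear_diag_gap] linear_diff[OF linear_diag_gap]
          linear_cmul[OF linear_diag_gap])
    moreover have "Z $ None $ None = 1" by (simp add: Z_def Y00)
    ultimately have "Z \<in> rlt_affine q A b" by (simp add: rlt_affine_iff E_def)
    from W[OF this] W[OF Y0] show ?thesis by (simp add: Z_def tr_inner_simps)
  qed
  from linear_factor[OF lin linear_diag_gap E this]
  obtain l where l: "\<And>Y. Y \<in> E \<Longrightarrow> tr_inner W Y = l \<bullet> diag_gap Y" by blast
  have "v \<bullet> (W *v v) = v \<bullet> (gap_form l *v v)" if v: "v \<in> ?V" for v
  proof -
    have "outer v \<in> E"
      unfolding E_def using outer_psd_on[OF V v] by (simp add: psd_on_def psd_coneD)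
    then show ?thesis
      using l[of "outer v"] tr_inner_gap_form[of "outer v" l]
      by (simp add: tr_inner_outer E_def)
  qed
  then show ?thesis by blast
qed

section \<open>The upper bound\<close>

text \<open>A facial reduction step in terms of subspaces; \<open>V' \<noteq> V\<close> corresponds
  to the matrix not being orthogonal to the current face.\<close>

definition gap_step :: "real^'n::finite \<Rightarrow> (real^('n::finite option)) set \<Rightarrow> (real^('n::finite option)) set \<Rightarrow> bool" where
  "gap_step l V V' \<longleftrightarrow> (\<forall>v\<in>V. 0 \<le> v \<bullet> (gap_form l *v v)) \<and>
     V' = {v \<in> V. v \<bullet> (gap_form l *v v) = 0} \<and> V' \<noteq> V"

inductive gap_chain :: "(real^('n::finite option)) set \<Rightarrow> nat \<Rightarrow> (real^('n::finite option)) set \<Rightarrow> bool" where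
  Nil: "gap_chain V 0 V"
| Cons: "gap_step l V V' \<Longrightarrow> gap_chain V' k V'' \<Longrightarrow> gap_chain V (Suc k) V''"

lemma gap_step_subspace:
  assumes "gap_step l V V'" "subspace V"
  shows "subspace V'" "V' \<subseteq> V"
  using subspace_mat_kernel[OF gap_form_sym assms(2), of l] assms(1) by (auto simp: gap_step_def)

lemma gap_chain_subspace:
  assumes "gap_chain V k V''" "subspace V"
  shows "subspace V'' \<and> V'' \<subseteq> V"
  using assms
proof (induction rule: gap_chain.induct)
  case (Cons l V V' k V'')
  then show ?case using gap_step_subspace[OF Cons(1,4)] by blast
qed simp

lemma gap_chain_snoc:
  assumes "gap_chain V k V'" "gap_step l V' V''"
  shows "gap_chain V (Suc k) V''"
  using assms by (induction rule: gap_chain.induct) (auto intro: gap_chain.intros)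

text \<open>The reflection \<open>x\<^sub>i \<mapsto> x\<^sub>0 - x\<^sub>i\<close> preserves \<open>x\<^sub>i\<^sup>2 - x\<^sub>0 x\<^sub>i\<close>; it moves the
  binary point \<open>p\<close> to \<open>0\<close>, which explains the signs \<open>2 p\<^sub>i - 1\<close>.\<close>

definition sign_lift :: "real^'n option \<Rightarrow> real^'n \<Rightarrow> real^'n option" where
  "sign_lift p z = (\<chi> a. case a of None \<Rightarrow> 0 | Some i \<Rightarrow> (2 * p $ Some i - 1) * z $ i)"

lemma linear_sign_lift: "linear (sign_lift p)"
  by (rule linearI) (auto simp: sign_lift_def vec_eq_iff algebra_simps split: option.splits)

lemma sign_lift_form:
  fixes p :: "real^('n::finite option)"
  assumes "\<And>i. p $ Some i \<in> {0, 1}"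
  shows "sign_lift p z \<bullet> (gap_form l *v sign_lift p z) = l \<bullet> (z * z)"
proof -
  have eq: "l $ i * (sign_lift p z $ Some i * sign_lift p z $ Some i - sign_lift p z $ None * sign_lift p z $ Some i)
      = l $ i * (z $ i * z $ i)" for i
    using assms[of i] by (auto simp: sign_lift_def)
  show ?thesis unfolding gap_form_eval eq by (simp add: inner_vec_def)
qed

text \<open>The form vanishes at the binary point \<open>p\<close>, so \<open>p\<close> is in its
  radical on \<open>V\<close> and shifting by multiples of \<open>p\<close> changes no value. Such
  shifts isolate the linear part of the form and move any vector of \<open>V\<close> to
  \<open>x0 = 0\<close>.\<close>

lemma gap_step_weight_step:
  fixes p :: "real^('n::finite option)"
  assumes p: "p $ None = 1" "\<And>i. p $ Some i \<in> {0, 1}" "p \<in> V"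
    and V: "subspace V" and st: "gap_step l V V'"
  shows "weight_step l {z. sign_lift p z \<in> V} {z. sign_lift p z \<in> V'}" "p \<in> V'"
proof -
  let ?q = "\<lambda>v. v \<bullet> (gap_form l *v v)"
  have qp: "?q p = 0" unfolding gap_form_eval using p(1,2) by (intro sum.neutral) force
  then show "p \<in> V'" using st p by (simp add: gap_step_def)
  have pos: "v \<in> V \<Longrightarrow> 0 \<le> ?q v" for v using st by (simp add: gap_step_def)
  have ker: "w \<bullet> (gap_form l *v p) = 0" if "w \<in> V" for w
    using mat_form_kernel[OF gap_form_sym V pos p(3) qp that] .
  have qadd: "?q (w + c *\<^sub>R p) = ?q w" if "w \<in> V" for w c
    using ker[OF that] qp sym_mats_form[OF gap_form_sym, of p l w]
    by (simp add: matrix_vector_right_distrib matrix_vector_mult_scaleR inner_add_left inner_add_right)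
  have lin: "l \<bullet> z = 0" if z: "sign_lift p z \<in> V" for z
  proof -
    have "0 = ?q (sign_lift p z + 1 *\<^sub>R p) - ?q (sign_lift p z)"
      using qadd[OF z, of 1] by simp
    also have "\<dots> = (\<Sum>i\<in>UNIV. l $ i * z $ i)"
      unfolding gap_form_eval sum_subtractf[symmetric]
    proof (intro sum.cong refl)
      fix i
      show "l $ i * ((sign_lift p z + 1 *\<^sub>R p) $ Some i * (sign_lift p z + 1 *\<^sub>R p) $ Some i -
          (sign_lift p z + 1 *\<^sub>R p) $ None * (sign_lift p z + 1 *\<^sub>R p) $ Some i) -
        l $ i * (sign_lift p z $ Some i * sign_lift p z $ Some i - sign_lift p z $ None * sign_lift p z $ Some i) =
        l $ i * z $ i"
        using p(2)[of i] p(1) by (auto simp: sign_lift_def algebra_simps)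
    qed
    finally show ?thesis by (simp add: inner_vec_def)
  qed
  have ne: "\<exists>z. sign_lift p z \<in> V \<and> sign_lift p z \<notin> V'"
  proof -
    obtain v where v: "v \<in> V" "?q v \<noteq> 0" using st by (auto simp: gap_step_def)
    \<comment> \<open>The witness that the step is proper is moved to \<open>x0 = 0\<close>, where
      it has a preimage under \<open>sign_lift\<close>.\<close>
    define x where "x = v + (- v $ None) *\<^sub>R p"
    have x: "x \<in> V" unfolding x_def using v(1) p(3) V by (intro subspace_add subspace_scale)
    have qx: "?q x \<noteq> 0" unfolding x_def by (subst qadd[OF v(1)]) (rule v(2))
    define z where "z = (\<chi> i. (2 * p $ Some i - 1) * x $ Some i)"
    have "sign_lift p z = x"
      unfolding vec_eq_iff
    proof
      fix a
      show "sign_lift p z $ a = x $ a"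
      proof (cases a)
        case None
        then show ?thesis using p(1) by (simp add: sign_lift_def x_def)
      next
        case (Some i)
        then show ?thesis using p(2)[of i] by (auto simp: sign_lift_def z_def)
      qed
    qed
    then show ?thesis using x qx st by (auto simp: gap_step_def)
  qed
  show "weight_step l {z. sign_lift p z \<in> V} {z. sign_lift p z \<in> V'}"
    unfolding weight_step_def
  proof (intro conjI ballI)
    show "{z. sign_lift p z \<in> V'} = {u \<in> {z. sign_lift p z \<in> V}. l \<bullet> (u * u) = 0}"
      using st by (auto simp: gap_step_def sign_lift_form[OF p(2)])
  next
    fix u assume "u \<in> {z. sign_lift p z \<in> V}"
    then show "l \<bullet> u = 0" "0 \<le> l \<bullet> (u * u)"
      using lin pos sign_lift_form[OF p(2)] by (auto, metis)
  qed (use ne in blast)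
qed

lemma gap_chain_weight_chain:
  fixes p :: "real^('n::finite option)"
  assumes "gap_chain V k V''" "subspace V"
    "p $ None = 1" "\<And>i. p $ Some i \<in> {0, 1}" "p \<in> V"
  shows "weight_chain {z. sign_lift p z \<in> V} k"
  using assms
proof (induction rule: gap_chain.induct)
  case Nil
  show ?case by (rule weight_chain.Nil)
next
  case (Cons l V V' k V'')
  show ?case
    using gap_step_weight_step[OF Cons.prems(2-4) Cons.prems(1) Cons.hyps(1)]
      gap_step_subspace[OF Cons.hyps(1) Cons.prems(1)] Cons.IH Cons.prems
    by (blast intro: weight_chain.Cons)
qed

lemma gap_chain_le:
  fixes p :: "real^('n::finite option)"
  assumes "gap_chain V k V''" "subspace V"
    "p $ None = 1" "\<And>i. p $ Some i \<in> {0, 1}" "p \<in> V"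
  shows "k \<le> CARD('n) div 2" "V = UNIV \<Longrightarrow> k = 0"
proof -
  have "subspace {z. sign_lift p z \<in> V}"
    using linear_subspace_vimage[OF linear_sign_lift assms(2)] by (simp add: vimage_def)
  from weight_chain_le_half[OF gap_chain_weight_chain[OF assms] this]
  show "k \<le> CARD('n) div 2" "V = UNIV \<Longrightarrow> k = 0" by auto
qed

section \<open>From chains of subspaces to facial reduction sequences\<close>

inductive face_path :: "(real^'m^'m) set \<Rightarrow> (real^'m^'m) set \<Rightarrow> nat \<Rightarrow> (real^'m^'m) set \<Rightarrow> bool"
  for L where
  Nil: "F face_of psd_cone \<Longrightarrow> face_path L F 0 F"
| Cons: "F face_of psd_cone \<Longrightarrow> W \<in> perp L \<inter> (dual_cone F - perp F) \<Longrightarrow>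
    face_path L (F \<inter> perp {W}) d G \<Longrightarrow> face_path L F (Suc d) G"

lemma face_path_sequence:
  assumes "face_path L F d G"
  shows "\<exists>Fs Ws. Fs 0 = F \<and> (\<forall>j\<le>d. Fs j face_of psd_cone) \<and>
     (\<forall>j\<in>{1..d}. Ws j \<in> perp L \<inter> (dual_cone (Fs (j - 1)) - perp (Fs (j - 1))) \<and>
                 Fs j = Fs (j - 1) \<inter> perp {Ws j}) \<and> Fs d = G"
  using assms
proof (induction rule: face_path.induct)
  case (Nil F)
  then show ?case by (intro exI[of _ "\<lambda>_. F"]) simp
next
  case (Cons F W d G)
  then obtain Fs Ws where *: "Fs 0 = F \<inter> perp {W}" "\<forall>j\<le>d. Fs j face_of psd_cone"
     "\<And>j. j \<in> {1..d} \<Longrightarrow> Ws j \<in> perp L \<inter> (dual_cone (Fs (j - 1)) - perp (Fs (j - 1)))"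
     "\<And>j. j \<in> {1..d} \<Longrightarrow> Fs j = Fs (j - 1) \<inter> perp {Ws j}" "Fs d = G"
    by blast
  \<comment> \<open>Faces are indexed from 0 but matrices from 1, so \<open>F\<close> is prepended
    at 0 and \<open>W\<close> at 1.\<close>
  define Fs' where "Fs' = case_nat F Fs"
  define Ws' where "Ws' j = (if j = 1 then W else Ws (j - 1))" for j
  have "Ws' j \<in> perp L \<inter> (dual_cone (Fs' (j - 1)) - perp (Fs' (j - 1))) \<and>
      Fs' j = Fs' (j - 1) \<inter> perp {Ws' j}" if "j \<in> {1..Suc d}" for j
  proof -
    obtain i where i: "j = Suc i" "i \<le> d" using \<open>j \<in> {1..Suc d}\<close> by (cases j) auto
    show ?thesis
    proof (cases i)
      case 0
      then show ?thesis using i Cons.hyps(2) *(1) by (simp add: Fs'_def Ws'_def)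
    next
      case (Suc m)
      then have "i \<in> {1..d}" using i by simp
      then show ?thesis using i *(3,4)[of i] Suc by (simp add: Fs'_def Ws'_def)
    qed
  qed
  moreover have "Fs' j face_of psd_cone" if "j \<le> Suc d" for j
    using that *(2) Cons.hyps(1) by (cases j) (auto simp: Fs'_def)
  moreover have "Fs' 0 = F" "Fs' (Suc d) = G" using *(5) by (simp_all add: Fs'_def)
  ultimately show ?case by blast
qed

lemma singularity_degree_le:
  assumes "face_path L psd_cone d (min_face L)"
  shows "singularity_degree L \<le> enat d"
  using face_path_sequence[OF assms]
  unfolding singularity_degree_def facial_reduction_seq_def by (blast intro: INF_lower)

lemma gap_step_face:
  assumes "gap_step l V V'" "subspace V"
  shows "psd_on V \<inter> perp {gap_form l} = psd_on V'"
    "gap_form l \<in> perp (rlt_affine q A b) \<inter> (dual_cone (psd_on V) - perp (psd_on V))"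
proof -
  have pos: "v \<in> V \<Longrightarrow> 0 \<le> v \<bullet> (gap_form l *v v)" for v
    using assms(1) by (simp add: gap_step_def)
  have V': "V' = {v \<in> V. v \<bullet> (gap_form l *v v) = 0}" "V' \<noteq> V"
    using assms(1) by (auto simp: gap_step_def)
  show "psd_on V \<inter> perp {gap_form l} = psd_on V'"
    unfolding V'(1) by (rule psd_on_Int_perp[OF gap_form_sym pos assms(2)])
  obtain v where v: "v \<in> V" "v \<bullet> (gap_form l *v v) \<noteq> 0" using V' by blast
  show "gap_form l \<in> perp (rlt_affine q A b) \<inter> (dual_cone (psd_on V) - perp (psd_on V))"
    using dual_cone_psd_on[OF gap_form_sym pos] gap_form_perp not_perp_psd_on[OF assms(2) v] by blast
qed

lemma gap_chain_face_path:
  assumes "gap_chain V k V''" "subspace V"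
  shows "face_path (rlt_affine q A b) (psd_on V) k (psd_on V'')"
  using assms
proof (induction rule: gap_chain.induct)
  case (Nil V)
  then show ?case by (intro face_path.Nil face_psd_on)
next
  case (Cons l V V' k V'')
  note f = gap_step_face[OF Cons.hyps(1) Cons.prems]
  show ?case
    using Cons.IH[OF gap_step_subspace(1)[OF Cons.hyps(1) Cons.prems]] f
    by (intro face_path.Cons[OF face_psd_on[OF Cons.prems] f(2)]) simp
qed

lemma rlt_Int_psd_perp: "rlt_affine q A b \<inter> psd_cone \<subseteq> perp {gap_form l}"
  using gap_form_perp[of l q A b] tr_inner_commute[of _ "gap_form l"]
  by (auto simp: perp_def dest: psd_coneD)

lemma gap_chain_contains:
  assumes "gap_chain V k V''" "subspace V" "rlt_affine q A b \<inter> psd_cone \<subseteq> psd_on V"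
  shows "rlt_affine q A b \<inter> psd_cone \<subseteq> psd_on V''"
  using assms
proof (induction rule: gap_chain.induct)
  case (Cons l V V' k V'')
  have "rlt_affine q A b \<inter> psd_cone \<subseteq> psd_on V'"
    using rlt_Int_psd_perp[of q A b l] gap_step_face(1)[OF Cons.hyps(1) Cons.prems(1)] Cons.prems(2) by blast
  then show ?case using Cons.IH gap_step_subspace[OF Cons.hyps(1) Cons.prems(1)] by blast
qed

text \<open>If no form reduces \<open>V\<close>, then by separation some matrix of the relaxation is positive
  definite on \<open>V\<close>.\<close>

lemma irreducible_min_face:
  fixes A :: "nat \<Rightarrow> real^'n::finite" and b :: "nat \<Rightarrow> real" and q :: nat
  assumes V: "subspace V" "V \<subseteq> feasible_space q A b" "p \<in> V" "p $ None = 1"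
    and irr: "\<And>l V'. \<not> gap_step l V V'"
  shows "psd_on V \<subseteq> min_face (rlt_affine q A b)"
proof -
  \<comment> \<open>The aim is an element of \<open>S\<close> with zero diagonal gap: rescaled, it
    lies in the relaxation and is positive definite on \<open>V\<close>.\<close>
  define S where "S = {Y \<in> psd_on V. \<forall>v\<in>V. v \<noteq> 0 \<longrightarrow> 0 < v \<bullet> (Y *v v)}"
  obtain P where P: "P \<in> sym_mats" "\<And>x. P *v x \<in> V"
    "\<And>x b. b \<in> V \<Longrightarrow> (x - P *v x) \<bullet> b = 0" "\<And>v. v \<in> V \<Longrightarrow> P *v v = v"
    "\<And>v. v \<bullet> (P *v v) = (P *v v) \<bullet> (P *v v)"
    using orth_projection_matrix[OF V(1)] by metis
  have PS: "Z + e *\<^sub>R P \<in> S" if "Z \<in> psd_on V" "e > 0" for Z e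
  proof -
    have "P \<in> psd_on V" using P by (auto simp: psd_on_def psd_cone_def)
    then have "Z + e *\<^sub>R P \<in> psd_on V"
      using that V(1) by (simp add: psd_on_add psd_on_scaleR)
    moreover have "0 < v \<bullet> ((Z + e *\<^sub>R P) *v v)" if "v \<in> V" "v \<noteq> 0" for v
    proof -
      have "0 \<le> v \<bullet> (Z *v v)" using \<open>Z \<in> psd_on V\<close> by (auto simp: psd_on_def intro: psd_coneD)
      moreover have "0 < e * (v \<bullet> (P *v v))" using that \<open>e > 0\<close> P(4) by simp
      ultimately show ?thesis
        by (simp add: matrix_vector_mult_add_rdistrib scaleR_matrix_vector_assoc[symmetric] inner_add_right)
    qed
    ultimately show ?thesis by (simp add: S_def)
  qed
  have "convex S"
  proof (rule convexI)
    fix X Y and s t :: real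
    assume XY: "X \<in> S" "Y \<in> S" and st: "0 \<le> s" "0 \<le> t" "s + t = 1"
    have "0 < v \<bullet> ((s *\<^sub>R X + t *\<^sub>R Y) *v v)" if v: "v \<in> V" "v \<noteq> 0" for v
    proof -
      have "0 < v \<bullet> (X *v v)" "0 < v \<bullet> (Y *v v)" using XY v by (auto simp: S_def)
      then have "0 < s * (v \<bullet> (X *v v)) + t * (v \<bullet> (Y *v v))"
        using st by (cases "s = 0") (auto intro: add_pos_nonneg)
      then show ?thesis
        by (simp add: matrix_vector_mult_add_rdistrib scaleR_matrix_vector_assoc[symmetric] inner_add_right)
    qed
    moreover have "s *\<^sub>R X + t *\<^sub>R Y \<in> psd_on V"
      using XY st V(1) by (simp add: S_def psd_on_add psd_on_scaleR)
    ultimately show "s *\<^sub>R X + t *\<^sub>R Y \<in> S" by (simp add: S_def)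
  qed
  then have conv: "convex (diag_gap ` S)" by (intro convex_linear_image linear_diag_gap)
  have zero: "0 \<in> psd_on V"
    using subspace_0[OF V(1)] by (simp add: psd_on_def psd_cone_def sym_mats_iff)
  have tr: "l \<bullet> diag_gap Y = tr_inner (gap_form l) Y" if "Y \<in> psd_on V" for l Y
    using that by (simp add: tr_inner_gap_form psd_on_def psd_coneD)
  have "0 \<in> diag_gap ` S"
  proof (rule ccontr)
    assume 0: "0 \<notin> diag_gap ` S"
    have "diag_gap ` S \<noteq> {}" using PS[OF zero, of 1] by auto
    \<comment> \<open>Since \<open>l\<close> is taken nonzero in the span of the image, it cannot
      annihilate the whole image.\<close>
    from separating_hyperplane_set_0_inspan[OF conv this 0]
    obtain l where l: "l \<in> span (diag_gap ` S)" "l \<noteq> 0" "\<And>x. x \<in> diag_gap ` S \<Longrightarrow> 0 \<le> l \<bullet> x"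
      by blast
    have pos: "0 \<le> v \<bullet> (gap_form l *v v)" if v: "v \<in> V" for v
    proof (rule ccontr)
      define m where "m = v \<bullet> (gap_form l *v v)"
      define c where "c = l \<bullet> diag_gap P"
      assume "\<not> ?thesis"
      then have m: "m < 0" by (simp add: m_def)
      \<comment> \<open>Small enough that adding \<open>e *\<^sub>R P\<close>, needed to land in
        \<open>S\<close>, raises the negative value \<open>m\<close> by at most
        \<open>- m / 2\<close>.\<close>
      define e where "e = - m / (2 * (\<bar>c\<bar> + 1))"
      have e: "e > 0" unfolding e_def using m by (intro divide_pos_pos) auto
      have "0 \<le> l \<bullet> diag_gap (outer v + e *\<^sub>R P)"
        using PS[OF outer_psd_on[OF V(1) v] e] l(3) by blast
      also have "\<dots> = m + e * c"
        using tr[OF outer_psd_on[OF V(1) v]]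
        by (simp add: linear_add[OF linear_diag_gap] linear_cmul[OF linear_diag_gap]
            inner_add_right tr_inner_outer m_def c_def)
      also have "e * c \<le> e * (\<bar>c\<bar> + 1)" using e by (intro mult_left_mono) auto
      also have "e * (\<bar>c\<bar> + 1) = - m / 2" unfolding e_def by (simp add: field_simps)
      finally show False using m by simp
    qed
    \<comment> \<open>A nonnegative form not identically zero on \<open>V\<close> would give a step,
      against irreducibility.\<close>
    have "v \<bullet> (gap_form l *v v) = 0" if "v \<in> V" for v
      using irr[of l "{v \<in> V. v \<bullet> (gap_form l *v v) = 0}"] pos that
      unfolding gap_step_def by blast
    then have "psd_on V \<subseteq> perp {gap_form l}"
      using psd_on_Int_perp[OF gap_form_sym pos V(1)] by (auto simp: psd_on_def)
    then have "l \<bullet> diag_gap Y = 0" if "Y \<in> S" for Y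
      using that tr[of Y l] tr_inner_commute[of Y "gap_form l"] by (auto simp: S_def perp_def)
    then have "\<forall>y \<in> diag_gap ` S. orthogonal l y" by (auto simp: orthogonal_def)
    then have "orthogonal l l" using l(1) orthogonal_to_span by blast
    then show False using l(2) by (simp add: orthogonal_def)
  qed
  then obtain Y where Y: "Y \<in> S" "diag_gap Y = 0" by force
  have YV: "Y \<in> psd_on V" and Ypos: "\<And>v. v \<in> V \<Longrightarrow> v \<noteq> 0 \<Longrightarrow> 0 < v \<bullet> (Y *v v)"
    using Y(1) by (auto simp: S_def)
  \<comment> \<open>Because \<open>p\<close> has leading coordinate 1, \<open>e0\<close> is not
    orthogonal to \<open>V\<close>. Its projection \<open>w\<close> is nonzero, and definiteness on
    \<open>V\<close> makes the corner entry of \<open>Y\<close> positive, so \<open>Y\<close> can be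
    rescaled.\<close>
  define e0 :: "real^'n option" where "e0 = axis None 1"
  define w where "w = P *v e0"
  have "w \<noteq> 0"
  proof
    assume "w = 0"
    then have "e0 \<bullet> p = 0" using P(3)[OF V(3), of e0] by (simp add: w_def)
    then show False using V(4) by (simp add: e0_def inner_axis')
  qed
  have "Y *v (e0 - w) = 0"
    by (rule psd_on_perp_kernel[OF YV]) (simp add: w_def P(3))
  then have Yw: "Y *v e0 = Y *v w" by (simp add: matrix_vector_mult_diff_distrib)
  have Y00: "Y $ None $ None > 0"
  proof (rule ccontr)
    assume "\<not> ?thesis"
    moreover have "Y $ None $ None = e0 \<bullet> (Y *v e0)"
      by (simp add: e0_def inner_axis' matrix_vector_mult_basis column_def)
    ultimately have "e0 \<bullet> (Y *v e0) = 0"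
      using psd_coneD(2)[of Y e0] YV by (simp add: psd_on_def)
    then have "Y *v e0 = 0" using YV by (intro psd_null) (simp_all add: psd_on_def)
    then show False using Ypos[of w] \<open>w \<noteq> 0\<close> P(2) Yw by (simp add: w_def)
  qed
  define Z where "Z = (1 / Y $ None $ None) *\<^sub>R Y"
  have ZV: "Z \<in> psd_on V" unfolding Z_def using V(1) YV Y00 by (simp add: psd_on_scaleR)
  have "Z $ None $ None = 1" "diag_gap Z = 0"
    using Y00 Y(2) by (simp_all add: Z_def linear_cmul[OF linear_diag_gap])
  then have ZL: "Z \<in> rlt_affine q A b"
    unfolding rlt_affine_iff using ZV V(2) by (auto simp: psd_on_def psd_coneD)
  show ?thesis
  proof (rule psd_on_subset_min_face[OF V(1) ZL ZV])
    fix v assume "v \<in> V" "v \<noteq> 0"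
    then show "0 < v \<bullet> (Z *v v)"
      using Ypos Y00 by (simp add: Z_def scaleR_matrix_vector_assoc[symmetric])
  qed
qed

lemma face_psd_cone: "psd_cone face_of psd_cone"
  using face_psd_on[OF subspace_UNIV] by (simp add: psd_on_UNIV)

text \<open>A longest chain from the feasible space ends in an irreducible subspace, which yields
  the minimal face. Its length is bounded through the binary point, and its first step absorbs the
  restriction to the feasible space.\<close>

lemma singularity_degree_upper:
  fixes A :: "nat \<Rightarrow> real^'n::finite"
  assumes "binary_solutions q A b \<noteq> {}"
  shows "singularity_degree (rlt_affine q A b) \<le> enat (max 1 (CARD('n) div 2))"
proof -
  let ?L = "rlt_affine q A b" and ?V = "feasible_space q A b"
  note V = subspace_feasible_space[of q A b]
  obtain x where x: "\<And>i. x $ i \<in> {0, 1}" "\<And>k. k < q \<Longrightarrow> A k \<bullet> x = b k"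
    using assms by (auto simp: binary_solutions_def)
  define p where "p = (\<chi> a. case a of None \<Rightarrow> 1 | Some i \<Rightarrow> x $ i)"
  have p: "p $ None = 1" "\<And>i. p $ Some i \<in> {0, 1}" using x by (simp_all add: p_def)
  have pV: "p \<in> ?V"
    unfolding feasible_space_def using x(2)
    by (simp add: inner_vec_def sum_option homog_row_def p_def)
  note le = gap_chain_le[OF _ V p pV]
  define k where "k = (GREATEST k. \<exists>V'. gap_chain ?V k V')"
  have "\<exists>V'. gap_chain ?V k V'"
    unfolding k_def by (rule GreatestI_nat[of _ 0 "CARD('n)"]) (auto intro: gap_chain.Nil dest: le(1))
  then obtain V' where ch: "gap_chain ?V k V'" by blast
  have irr: "\<not> gap_step l V' V''" for l V''
  proof
    assume "gap_step l V' V''"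
    from gap_chain_snoc[OF ch this]
    have "Suc k \<le> k"
      unfolding k_def by (intro Greatest_le_nat[of _ _ "CARD('n)"]) (auto dest: le(1))
    then show False by simp
  qed
  have sub: "subspace V'" "V' \<subseteq> ?V" using gap_chain_subspace[OF ch V] by auto
  have "rlt_affine q A b \<inter> psd_cone \<subseteq> psd_on V'"
    by (rule gap_chain_contains[OF ch V rlt_Int_psd_subset])
  moreover have "outer p \<in> rlt_affine q A b" by (rule outer_rlt_affine[OF p pV])
  moreover have "p \<in> V'"
  proof -
    have "gap_chain U j U' \<Longrightarrow> subspace U \<Longrightarrow> p \<in> U \<Longrightarrow> p \<in> U'" for U j U'
      by (induction rule: gap_chain.induct)
        (use gap_step_weight_step(2)[OF p] gap_step_subspace in blast)+
    then show ?thesis using ch V pV by blast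
  qed
  ultimately have mf: "min_face ?L = psd_on V'"
    using irreducible_min_face[OF sub _ p(1) irr] min_face_subset[OF face_psd_on[OF sub(1)]] by blast
  have "\<exists>d\<le>max 1 (CARD('n) div 2). face_path ?L psd_cone d (psd_on V')"
  proof (cases "?V = UNIV")
    case True
    then have "k = 0" using le(2)[OF ch] by simp
    then have "V' = UNIV" using ch True by (auto elim: gap_chain.cases)
    then show ?thesis using face_path.Nil[OF face_psd_cone] by (auto simp: psd_on_UNIV)
  next
    case False
    have step: "face_path ?L psd_cone (Suc j) (psd_on V')"
      if *: "gap_chain V1 j V'" "subspace V1" "V1 = {v \<in> ?V. v \<bullet> (gap_form l *v v) = 0}"
        "\<And>v. v \<in> ?V \<Longrightarrow> 0 \<le> v \<bullet> (gap_form l *v v)" for j l V1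
    proof -
      obtain W where "W \<in> perp ?L \<inter> (dual_cone psd_cone - perp psd_cone)"
          "psd_cone \<inter> perp {W} = psd_on V1"
        using initial_reduction[OF False *(4)] *(3) by blast
      then show ?thesis
        using gap_chain_face_path[OF *(1,2)] by (auto intro: face_path.Cons[OF face_psd_cone])
    qed
    show ?thesis
    proof (cases k)
      case 0
      then have "V' = ?V" using ch by (auto elim: gap_chain.cases)
      \<comment> \<open>With the zero form a single step is spent on the restriction alone; hence
        the maximum with 1.\<close>
      moreover have "v \<bullet> (gap_form 0 *v v) = 0" for v :: "real^'n option" by (simp add: gap_form_eval)
      ultimately have "face_path ?L psd_cone (Suc 0) (psd_on V')"
        by (intro step[of ?V 0 0]) (auto intro: gap_chain.Nil V)
      then show ?thesis by (intro exI[of _ 1]) simp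
    next
      case (Suc j)
      then obtain l V1 where st: "gap_step l ?V V1" "gap_chain V1 j V'"
        using ch by (auto elim: gap_chain.cases)
      have "face_path ?L psd_cone (Suc j) (psd_on V')"
        by (rule step[OF st(2) gap_step_subspace(1)[OF st(1) V], of l]) (use st(1) in \<open>auto simp: gap_step_def\<close>)
      then show ?thesis using le(1)[OF ch] Suc by (intro exI[of _ k]) auto
    qed
  qed
  then obtain d where "d \<le> max 1 (CARD('n) div 2)" "face_path ?L psd_cone d (psd_on V')" by blast
  then show ?thesis
    using singularity_degree_le[of ?L d] mf by (metis enat_ord_simps(1) order_trans)
qed

section \<open>The lower bound\<close>

text \<open>The values at the entries of \<open>x\<close> of real polynomials of degree at most
  \<open>m\<close> without constant term.\<close>

definition power_span :: "real^'n::finite \<Rightarrow> nat \<Rightarrow> (real^'n) set" where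
  "power_span x m = span ((^) x ` {1..m})"

lemma vec_power_nth: "(x ^ j) $ i = (x $ i :: real) ^ j"
  by (induction j) simp_all

lemma power_span_coeffs:
  assumes "y \<in> power_span x m"
  shows "\<exists>c. c 0 = 0 \<and> (\<forall>i. y $ i = (\<Sum>j\<le>m. c j * (x $ i) ^ j))"
  using assms unfolding power_span_def
proof (induction y rule: span_induct_alt)
  case base
  show ?case by (intro exI[of _ "\<lambda>_. 0"]) simp
next
  case (step a s y)
  then obtain c k where c: "c 0 = 0" "\<And>i. y $ i = (\<Sum>j\<le>m. c j * (x $ i) ^ j)"
    and k: "k \<in> {1..m}" "s = x ^ k" by blast
  have "(a *\<^sub>R s + y) $ i = (\<Sum>j\<le>m. (c j + (if j = k then a else 0)) * (x $ i) ^ j)" for i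
    using k by (simp add: c(2) vec_power_nth distrib_right sum.distrib if_distrib[of "\<lambda>a. a * _"] cong: if_cong)
  then show ?case using c(1) k(1) by (intro exI[of _ "\<lambda>j. c j + (if j = k then a else 0)"]) auto
qed

text \<open>A dependence would be a nonzero polynomial of degree \<open>Suc m\<close> vanishing at
  0, for lack of a constant term, and at all the distinct nonzero entries of \<open>x\<close>: one
  root too many.\<close>

lemma power_notin_span:
  fixes x :: "real^'n::finite"
  assumes x: "inj (($) x)" "\<And>i. x $ i \<noteq> 0" and m: "Suc m \<le> CARD('n)"
  shows "x ^ Suc m \<notin> power_span x m"
proof
  assume "x ^ Suc m \<in> power_span x m"
  from power_span_coeffs[OF this]
  obtain c where c: "c 0 = 0" "\<And>i. (x $ i) ^ Suc m = (\<Sum>j\<le>m. c j * (x $ i) ^ j)"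
    by (auto simp: vec_power_nth)
  define c' where "c' j = (if j = Suc m then - 1 else c j)" for j
  let ?Z = "{z. (\<Sum>j\<le>Suc m. c' j * z ^ j) = 0}"
  have eval: "(\<Sum>j\<le>Suc m. c' j * z ^ j) = (\<Sum>j\<le>m. c j * z ^ j) - z ^ Suc m" for z
    by (simp add: c'_def)
  have "finite ?Z \<and> card ?Z \<le> Suc m"
    by (rule Transcendental.polyfun_rootbound[where k = "Suc m"]) (simp_all add: c'_def)
  moreover have "insert 0 (range (($) x)) \<subseteq> ?Z"
  proof -
    have "(\<Sum>j\<le>m. c j * 0 ^ j) = 0"
      using c(1) by (intro sum.neutral) (auto simp: power_0_left)
    then show ?thesis unfolding eval using c(2) by auto
  qed
  moreover have "card (insert 0 (range (($) x))) = Suc CARD('n)"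
  proof -
    have "0 \<notin> range (($) x)" using x(2) by (metis imageE)
    then show ?thesis using card_image[OF x(1)] by simp
  qed
  ultimately show False using m card_mono[of ?Z "insert 0 (range (($) x))"] by linarith
qed

lemma subspace_power_span: "subspace (power_span x m)"
  by (simp add: power_span_def)

lemma power_span_base: "1 \<le> j \<Longrightarrow> j \<le> m \<Longrightarrow> x ^ j \<in> power_span x m"
  unfolding power_span_def by (rule span_base) auto

lemma power_span_mono: "m \<le> m' \<Longrightarrow> power_span x m \<subseteq> power_span x m'"
  unfolding power_span_def by (rule span_mono) auto

lemma power_span_Suc: "y \<in> power_span x (Suc m) \<longleftrightarrow> (\<exists>c. y - c *\<^sub>R x ^ Suc m \<in> power_span x m)"
  by (simp only: power_span_def atLeastAtMostSuc_conv le_add1 plus_1_eq_Suc image_insert span_insert mem_Collect_eq)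

lemma power_span_orth:
  assumes "\<And>j. 1 \<le> j \<Longrightarrow> j \<le> m \<Longrightarrow> l \<bullet> x ^ j = 0" "y \<in> power_span x m"
  shows "l \<bullet> y = 0"
  using assms(2) unfolding power_span_def
  by (rule span_induct) (auto simp: subspace_def inner_add_right intro: assms(1))

lemma power_span_mult:
  assumes "y \<in> power_span x m" "z \<in> power_span x m'"
  shows "y * z \<in> power_span x (m + m')"
proof -
  have sub: "subspace {z. w * z \<in> power_span x (m + m')}" for w
    using subspace_power_span[of x "m + m'"] by (auto simp: subspace_def distrib_left)
  have base: "x ^ j * z \<in> power_span x (m + m')" if j: "j \<in> {1..m}" for j
  proof (rule span_induct[OF assms(2)[unfolded power_span_def] sub])
    fix y assume "y \<in> (^) x ` {1..m'}"
    then obtain i where "i \<in> {1..m'}" "y = x ^ i" by blast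
    then show "x ^ j * y \<in> power_span x (m + m')"
      using j by (simp only: power_add[symmetric]) (auto intro: power_span_base)
  qed
  have "z * y \<in> power_span x (m + m')"
  proof (rule span_induct[OF assms(1)[unfolded power_span_def] sub])
    fix y assume "y \<in> (^) x ` {1..m}"
    then show "z * y \<in> power_span x (m + m')" using base by (auto simp: mult.commute)
  qed
  then show ?thesis by (simp add: mult.commute)
qed

text \<open>\<open>l\<close> is the component of \<open>x ^ Suc m\<close> normal to the lower
  powers.\<close>

lemma moment_weight_exists:
  fixes x :: "real^'n::finite"
  assumes x: "inj (($) x)" "\<And>i. x $ i \<noteq> 0" and m: "Suc m \<le> CARD('n)"
  obtains l where "\<And>j. 1 \<le> j \<Longrightarrow> j \<le> m \<Longrightarrow> l \<bullet> x ^ j = 0" "0 < l \<bullet> x ^ Suc m"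
proof -
  obtain P where P: "linear P" "\<And>y. P y \<in> power_span x m"
      "\<And>y b. b \<in> power_span x m \<Longrightarrow> (y - P y) \<bullet> b = 0"
    using orth_projection_exists[OF subspace_power_span] by metis
  define l where "l = x ^ Suc m - P (x ^ Suc m)"
  have "l \<noteq> 0" using P(2)[of "x ^ Suc m"] power_notin_span[OF x m] by (auto simp: l_def)
  moreover have "l \<bullet> l = l \<bullet> x ^ Suc m"
    using P(3)[OF P(2), of "x ^ Suc m"] by (simp only: l_def inner_diff_right)
  ultimately have "0 < l \<bullet> x ^ Suc m" by (metis inner_gt_zero_iff)
  moreover have "l \<bullet> x ^ j = 0" if "1 \<le> j" "j \<le> m" for j
    unfolding l_def by (rule P(3)[OF power_span_base[OF that]])
  ultimately show thesis using that by blast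
qed

text \<open>The matrix of the form in the basis \<open>x, \<dots>, x\<^sup>m\<close> is the Hankel matrix of the moments
  \<open>l \<bullet> x\<^sup>j\<close>. Its first moments vanish, so its early diagonal entries do too, and positive
  semidefiniteness then kills all moments except \<open>l \<bullet> x\<^sup>2\<^sup>m\<close>.\<close>

lemma moments_vanish:
  fixes x :: "real^'n::finite"
  assumes lin: "\<And>z. z \<in> power_span x m \<Longrightarrow> l \<bullet> z = 0"
    and psd: "\<And>z. z \<in> power_span x m \<Longrightarrow> 0 \<le> l \<bullet> (z * z)"
  shows "1 \<le> j \<Longrightarrow> j < 2 * m \<Longrightarrow> l \<bullet> x ^ j = 0"
proof (induction j rule: less_induct)
  case (less j)
  show ?case
  proof (cases "j \<le> m")
    case True
    then show ?thesis using lin power_span_base less.prems by blast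
  next
    case False
    have a: "x ^ (j - m) \<in> power_span x m" "x ^ m \<in> power_span x m"
      using False less.prems by (auto intro!: power_span_base)
    \<comment> \<open>From \<open>j < 2 * m\<close> follows \<open>2 * (j - m) < j\<close>, so the
      induction hypothesis applies; \<open>x ^ (j - m)\<close> is isotropic and therefore pairs to
      zero with \<open>x ^ m\<close>.\<close>
    have "l \<bullet> (x ^ (j - m) * x ^ (j - m)) = 0"
      using less.IH[of "(j - m) + (j - m)"] False less.prems by (simp add: power_add[symmetric])
    then have "l \<bullet> (x ^ (j - m) * x ^ m) = 0"
      using psd_bilinear_kernel[OF bilinear_weight _ subspace_power_span psd a(1) _ a(2)]
      by (simp add: mult.commute)
    then show ?thesis using False by (simp add: power_add[symmetric])
  qed
qed

text \<open>The shape of the feasible space of a homogeneous system with solution space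
  \<open>U\<close>: the coordinate \<open>x0\<close> is free and the binary point is the
  origin.\<close>

definition cone_over :: "(real^'n::finite) set \<Rightarrow> (real^('n option)) set" where
  "cone_over U = {v. (\<chi> i. v $ Some i) \<in> U}"

lemma subspace_cone_over:
  fixes U :: "(real^'n::finite) set"
  assumes "subspace U"
  shows "subspace (cone_over U)"
proof -
  have "linear (\<lambda>v::real^('n option). \<chi> i. v $ Some i)"
    by (rule linearI) (simp_all add: vec_eq_iff)
  from linear_subspace_vimage[OF this assms] show ?thesis
    by (simp add: cone_over_def vimage_def)
qed

lemma gap_form_split:
  "v \<bullet> (gap_form l *v v) =
     l \<bullet> ((\<chi> i. v $ Some i) * (\<chi> i. v $ Some i)) - v $ None * (l \<bullet> (\<chi> i. v $ Some i))"
  unfolding gap_form_eval by (simp add: inner_vec_def sum_subtractf sum_distrib_left algebra_simps)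

text \<open>With \<open>x0 = t\<close> free, the form is affine in \<open>t\<close>, so its slope
  \<open>l \<bullet> z\<close> must vanish.\<close>

lemma gap_form_cone_over_nonneg:
  fixes U :: "(real^'n::finite) set"
  assumes pos: "\<And>v. v \<in> cone_over U \<Longrightarrow> 0 \<le> v \<bullet> (gap_form l *v v)" and z: "z \<in> U"
  shows "l \<bullet> z = 0" "0 \<le> l \<bullet> (z * z)"
proof -
  have *: "0 \<le> l \<bullet> (z * z) - t * (l \<bullet> z)" for t
    using pos[of "\<chi> a. case a of None \<Rightarrow> t | Some i \<Rightarrow> z $ i"] z
    by (simp add: gap_form_split cone_over_def)
  show "0 \<le> l \<bullet> (z * z)" using *[of 0] by simp
  show "l \<bullet> z = 0"
  proof (rule ccontr)
    assume "l \<bullet> z \<noteq> 0"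
    then show False using *[of "(l \<bullet> (z * z) + 1) / (l \<bullet> z)"] by simp
  qed
qed

text \<open>Products of two elements of \<open>power_span x m\<close> involve only powers up to
  \<open>2 * m\<close>, whose moments vanish. Hence one step removes at most the highest
  power.\<close>

lemma gap_form_power_span_kernel:
  fixes x :: "real^'n::finite"
  assumes pos: "\<And>v. v \<in> cone_over (power_span x (Suc m)) \<Longrightarrow> 0 \<le> v \<bullet> (gap_form l *v v)"
    and v: "v \<in> cone_over (power_span x m)"
  shows "v \<bullet> (gap_form l *v v) = 0"
proof -
  define z where "z = (\<chi> i. v $ Some i)"
  have z: "z \<in> power_span x m" using v by (simp add: cone_over_def z_def)
  note nn = gap_form_cone_over_nonneg[OF pos]
  have "l \<bullet> (z * z) = 0"
    by (rule power_span_orth[OF _ power_span_mult[OF z z]]) (use moments_vanish[OF nn] in auto)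
  moreover have "l \<bullet> z = 0" using nn(1) z power_span_mono[of m "Suc m" x] by auto
  ultimately show ?thesis by (simp add: gap_form_split z_def)
qed

text \<open>Bounds the minimal face from above: a weight whose first nonzero moment is that of
  \<open>x ^ Suc (2 * m + 1)\<close> removes the top power \<open>x ^ Suc m\<close>. It exists as
  long as \<open>2 * Suc m\<close> is at most the number of variables.\<close>

lemma rlt_subset_power_span:
  fixes x :: "real^'n::finite"
  assumes x: "inj (($) x)" "\<And>i. x $ i \<noteq> 0"
  shows "2 * m \<le> CARD('n) \<Longrightarrow> rlt_affine q A b \<inter> psd_cone \<subseteq> psd_on (cone_over (power_span x m))
    \<Longrightarrow> rlt_affine q A b \<inter> psd_cone \<subseteq> psd_on (cone_over (power_span x 0))"
proof (induction m)
  case (Suc m)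
  have "Suc (2 * m + 1) \<le> CARD('n)" using Suc.prems(1) by simp
  then obtain l where l: "\<And>j. 1 \<le> j \<Longrightarrow> j \<le> 2 * m + 1 \<Longrightarrow> l \<bullet> x ^ j = 0" "0 < l \<bullet> x ^ Suc (2 * m + 1)"
    using moment_weight_exists[OF x] by metis
  let ?V = "\<lambda>k. cone_over (power_span x k)"
  have V: "subspace (?V k)" for k by (simp add: subspace_cone_over subspace_power_span)
  have orth: "l \<bullet> y = 0" if "y \<in> power_span x k" "k \<le> 2 * m + 1" for y k
    by (rule power_span_orth[OF _ that(1)]) (use l(1) that(2) in auto)
  have form: "\<exists>c. v \<bullet> (gap_form l *v v) = c\<^sup>2 * (l \<bullet> x ^ Suc (2 * m + 1)) \<and> (c = 0 \<longrightarrow> v \<in> ?V m)"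
    if "v \<in> ?V (Suc m)" for v
  proof -
    define z where "z = (\<chi> i. v $ Some i)"
    have z: "z \<in> power_span x (Suc m)" using that by (simp add: cone_over_def z_def)
    then obtain c where c: "z - c *\<^sub>R x ^ Suc m \<in> power_span x m" using power_span_Suc by blast
    define u where "u = z - c *\<^sub>R x ^ Suc m"
    have u: "u \<in> power_span x m" using c by (simp add: u_def)
    have xm: "x ^ Suc m \<in> power_span x (Suc m)" by (rule power_span_base) auto
    have "z * z = u * u + (2 * c) *\<^sub>R (u * x ^ Suc m) + c\<^sup>2 *\<^sub>R (x ^ Suc m * x ^ Suc m)"
      unfolding vec_eq_iff by (simp add: u_def algebra_simps power2_eq_square del: power_Suc)
    moreover have "x ^ Suc m * x ^ Suc m = x ^ Suc (2 * m + 1)"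
      by (simp only: power_add[symmetric]) (simp add: mult_2)
    moreover have "l \<bullet> (u * u) = 0" "l \<bullet> (u * x ^ Suc m) = 0" "l \<bullet> z = 0"
      by (rule orth[OF power_span_mult[OF u u]] orth[OF power_span_mult[OF u xm]] orth[OF z]; simp)+
    ultimately have "v \<bullet> (gap_form l *v v) = c\<^sup>2 * (l \<bullet> x ^ Suc (2 * m + 1))"
      by (simp add: gap_form_split z_def[symmetric] inner_add_right del: power_Suc)
    moreover have "c = 0 \<longrightarrow> v \<in> ?V m" using u by (auto simp: cone_over_def u_def z_def)
    ultimately show ?thesis by blast
  qed
  have pos: "0 \<le> v \<bullet> (gap_form l *v v)" if "v \<in> ?V (Suc m)" for v
    using form[OF that] l(2) by auto
  have "{v \<in> ?V (Suc m). v \<bullet> (gap_form l *v v) = 0} \<subseteq> ?V m"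
    using form l(2) by fastforce
  then have "psd_on {v \<in> ?V (Suc m). v \<bullet> (gap_form l *v v) = 0} \<subseteq> psd_on (?V m)"
    by (rule psd_on_mono)
  moreover have "psd_on (?V (Suc m)) \<inter> perp {gap_form l} =
      psd_on {v \<in> ?V (Suc m). v \<bullet> (gap_form l *v v) = 0}"
    by (rule psd_on_Int_perp[OF gap_form_sym pos V])
  ultimately have "rlt_affine q A b \<inter> psd_cone \<subseteq> psd_on (?V m)"
    using Suc.prems(2) rlt_Int_psd_perp by blast
  then show ?case using Suc.IH Suc.prems(1) by simp
qed simp

lemma subspace_as_equations:
  fixes U :: "(real^'n) set"
  assumes U: "subspace U"
  obtains q and A :: "nat \<Rightarrow> real^'n" where "\<And>z. z \<in> U \<longleftrightarrow> (\<forall>k<q. A k \<bullet> z = 0)"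
proof -
  define C where "C = {y. \<forall>u\<in>U. y \<bullet> u = 0}"
  obtain B where B: "B \<subseteq> C" "independent B" "C \<subseteq> span B" by (meson basis_exists)
  then obtain bs where bs: "set bs = B" using independent_imp_finite finite_list by metis
  obtain P where P: "linear P" "\<And>y. P y \<in> U" "\<And>y b. b \<in> U \<Longrightarrow> (y - P y) \<bullet> b = 0"
    using orth_projection_exists[OF U] by blast
  have "z \<in> U \<longleftrightarrow> (\<forall>k<length bs. bs ! k \<bullet> z = 0)" for z
  proof
    assume "z \<in> U"
    then show "\<forall>k<length bs. bs ! k \<bullet> z = 0" using bs B(1) unfolding C_def by (auto dest: nth_mem)
  next
    assume "\<forall>k<length bs. bs ! k \<bullet> z = 0"
    then have "\<forall>y\<in>B. orthogonal z y"
      using bs by (metis in_set_conv_nth inner_commute orthogonal_def)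
    moreover have "z - P z \<in> span B" using B(3) P(3) unfolding C_def by blast
    ultimately have "orthogonal z (z - P z)" using orthogonal_to_span by blast
    moreover have "(z - P z) \<bullet> P z = 0" by (rule P(3)[OF P(2)])
    ultimately have "(z - P z) \<bullet> (z - P z) = 0"
      by (simp add: orthogonal_def inner_commute inner_diff_right)
    then show "z \<in> U" using P(2)[of z] by simp
  qed
  then show thesis by (rule that)
qed

text \<open>Whatever matrices are chosen, they act on the feasible space as gap forms, so after
  \<open>j\<close> steps the face still contains \<open>psd_on (?V (k - j))\<close>. The minimal
  face lies in \<open>psd_on (?V 0)\<close>, so fewer than \<open>k\<close> steps cannot reach
  it.\<close>

lemma singularity_degree_lower:
  "\<exists>q (A :: nat \<Rightarrow> real^'n::finite) b. binary_solutions q A b \<noteq> {} \<and>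
     enat (max 1 (CARD('n) div 2)) \<le> singularity_degree (rlt_affine q A b)"
proof -
  obtain f :: "'n \<Rightarrow> nat" where f: "inj f" using finite_imp_inj_to_nat_seg[of "UNIV :: 'n set"] by auto
  define x :: "real^'n" where "x = (\<chi> i. real (Suc (f i)))"
  have x: "inj (($) x)" "\<And>i. x $ i \<noteq> 0"
    using f by (auto simp: x_def inj_on_def)
  then have x0: "x \<noteq> 0" by auto
  define k where "k = CARD('n) div 2"
  obtain q and A :: "nat \<Rightarrow> real^'n"
    where A: "\<And>z. z \<in> power_span x k \<longleftrightarrow> (\<forall>k<q. A k \<bullet> z = 0)"
    using subspace_as_equations[OF subspace_power_span] by blast
  define b :: "nat \<Rightarrow> real" where "b = (\<lambda>_. 0)"
  let ?L = "rlt_affine q A b" and ?V = "\<lambda>k. cone_over (power_span x k)"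
  have V: "subspace (?V j)" for j by (simp add: subspace_cone_over subspace_power_span)
  have Vmono: "i \<le> j \<Longrightarrow> ?V i \<subseteq> ?V j" for i j
    using power_span_mono[of i j x] by (auto simp: cone_over_def)
  have feas: "feasible_space q A b = ?V k"
    unfolding feasible_space_def cone_over_def A
    by (simp add: inner_vec_def sum_option homog_row_def b_def)
  have "0 \<in> binary_solutions q A b" by (simp add: binary_solutions_def b_def)
  moreover have "max 1 k \<le> d" if seq: "facial_reduction_seq ?L d F W" for d F W
  proof (rule ccontr)
    assume d: "\<not> max 1 k \<le> d"
    have F: "F 0 = psd_cone" "F d = min_face ?L"
      and FW: "\<And>j. j \<in> {1..d} \<Longrightarrow> W j \<in> perp ?L \<inter> dual_cone (F (j - 1)) \<and> F j = F (j - 1) \<inter> perp {W j}"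
      using seq by (auto simp: facial_reduction_seq_def)
    have "outer (axis None 1) \<in> ?L"
      by (rule outer_rlt_affine) (auto simp: axis_def feas cone_over_def zero_vec_def[symmetric]
          subspace_0[OF subspace_power_span])
    then have ne: "?L \<noteq> {}" by blast
    have large: "j \<le> d \<Longrightarrow> j \<le> k \<Longrightarrow> psd_on (?V (k - j)) \<subseteq> F j" for j
    proof (induction j)
      case 0
      show ?case using F(1) by (auto simp: psd_on_def)
    next
      case (Suc j)
      then have IH: "psd_on (?V (k - j)) \<subseteq> F j" by simp
      have Wj: "W (Suc j) \<in> perp ?L" "W (Suc j) \<in> dual_cone (F j)" "F (Suc j) = F j \<inter> perp {W (Suc j)}"
        using FW[of "Suc j"] Suc.prems by auto
      obtain l where l: "\<And>v. v \<in> ?V k \<Longrightarrow> v \<bullet> (W (Suc j) *v v) = v \<bullet> (gap_form l *v v)"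
        using perp_rlt_affine_form[OF ne Wj(1)] feas by auto
      obtain m where m: "k - j = Suc m" using Suc.prems by (cases "k - j") auto
      then have mj: "k - Suc j = m" "Suc m \<le> k" by auto
      \<comment> \<open>Membership in the dual cone of \<open>F j\<close> gives nonnegativity on
        \<open>?V (Suc m)\<close>, since \<open>F j\<close> contains the outer products of its
        vectors.\<close>
      have "0 \<le> v \<bullet> (gap_form l *v v)" if "v \<in> ?V (Suc m)" for v
        using dual_cone_psd_onD[OF Wj(2) IH V, of v] l[of v] that Vmono[OF mj(2)] m by auto
      from gap_form_power_span_kernel[OF this]
      have zero: "v \<bullet> (W (Suc j) *v v) = 0" if "v \<in> ?V m" for v
        using l[of v] that Vmono[of m k] mj(2) by auto
      have "W (Suc j) \<in> sym_mats" using Wj(1) by (simp add: perp_def)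
      from psd_on_Int_perp[OF this _ V, of m] zero
      have "psd_on (?V m) \<inter> perp {W (Suc j)} = psd_on {v \<in> ?V m. v \<bullet> (W (Suc j) *v v) = 0}" by simp
      moreover have "{v \<in> ?V m. v \<bullet> (W (Suc j) *v v) = 0} = ?V m" using zero by blast
      ultimately have "psd_on (?V m) \<subseteq> perp {W (Suc j)}" by auto
      moreover have "psd_on (?V m) \<subseteq> psd_on (?V (Suc m))"
        by (intro psd_on_mono Vmono) simp
      ultimately show ?case using IH Wj(3) mj(1) m by auto
    qed
    \<comment> \<open>The point at \<open>x0 = 0\<close> over \<open>x\<close>: it lies in every
      \<open>?V j\<close> with \<open>j \<ge> 1\<close> but not in \<open>?V 0\<close>.\<close>
    define w :: "real^('n option)" where "w = (\<chi> a. case a of None \<Rightarrow> 0 | Some i \<Rightarrow> x $ i)"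
    have tail: "(\<chi> i. w $ Some i) = x" by (simp add: w_def vec_eq_iff)
    have "outer w \<in> F d"
    \<comment> \<open>The case \<open>d = 0\<close> is separate because \<open>k = 0\<close> for a
      single variable; there the full cone is still larger than the minimal face.\<close>
    proof (cases "d = 0")
      case True
      then show ?thesis using F(1) outer_psd by simp
    next
      case False
      then have dk: "d < k" using d by auto
      then have "x \<in> power_span x (k - d)" using power_span_base[of 1 "k - d" x] by simp
      then have "outer w \<in> psd_on (?V (k - d))"
        by (intro outer_psd_on V) (simp add: cone_over_def tail)
      then show ?thesis using large[of d] dk by auto
    qed
    also have "F d \<subseteq> psd_on (?V 0)"
      unfolding F(2)
      by (intro min_face_subset face_psd_on V rlt_subset_power_span[OF x, of k])
        (use rlt_Int_psd_subset[of q A b] feas in \<open>auto simp: k_def\<close>)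
    finally have "(w \<bullet> w) *\<^sub>R w \<in> ?V 0" unfolding psd_on_def by (metis (no_types, lifting) mem_Collect_eq outer_mult)
    moreover have "w $ Some i \<noteq> 0" for i using x(2) by (simp add: w_def)
    then have "w \<noteq> 0" by auto
    ultimately have "w \<in> ?V 0"
      using subspace_scale[OF V, of "(w \<bullet> w) *\<^sub>R w" 0 "1 / (w \<bullet> w)"] by simp
    then show False using x0 tail by (simp add: cone_over_def power_span_def)
  qed
  ultimately show ?thesis
    unfolding singularity_degree_def k_def by (intro exI[of _ q] exI[of _ A] exI[of _ b]) (auto intro!: INF_greatest)
qed

theorem corollary5p1:
  fixes n m :: nat and degrees :: "enat set"
  assumes "n = CARD('n::finite)" and "n \<ge> 1"
    and "m = (if n = 1 then 1 else n div 2)"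
    and "degrees = {singularity_degree (rlt_affine q A b) | q (A :: nat \<Rightarrow> real^'n) b.
                      binary_solutions q A b \<noteq> {}}"
  shows "enat m \<in> degrees \<and> (\<forall>s\<in>degrees. s \<le> enat m)"
proof -
  have m: "m = max 1 (CARD('n) div 2)"
  proof (cases "n = 1")
    case False
    then have "1 \<le> n div 2" using assms(2) by linarith
    then show ?thesis using assms(1,3) False by simp
  qed (use assms(1,3) in simp)
  have upper: "\<forall>s\<in>degrees. s \<le> enat m"
    unfolding assms(4) m using singularity_degree_upper by blast
  obtain q b and A :: "nat \<Rightarrow> real^'n" where "binary_solutions q A b \<noteq> {}"
      "enat m \<le> singularity_degree (rlt_affine q A b)"
    using singularity_degree_lower m by blast
  moreover from this have "singularity_degree (rlt_affine q A b) \<in> degrees"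
    unfolding assms(4) by blast
  ultimately show ?thesis using upper by (metis order_antisym)
qed

end
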